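(* Let $N$ be one of the following matroids: the uniform matroid $U_{2,k}$ for some integer $k \ge 2$, the uniform matroid $U_{3,6}$, or one of the matroids $P_6$, $Q_6$, $R_6$. For each $n$ let $\mathbb{M}_n$ denote the set of all matroids with ground set $[n]=\{1,\dots,n\}$. Then $$\lim_{n\to\infty} \frac{\#\{M \in \mathbb{M}_n : M \text{ does not have a minor isomorphic to } N\}}{\#\mathbb{M}_n} = 0.$$
   Context: $P_6$, $Q_6$, $R_6$ are the simple rank-3 matroids on six elements defined as follows (a 3-element set is dependent exactly when listed, all other 3-sets are bases). $P_6$ on $\{a,b,c,d,e,f\}$: the only dependent 3-set is $\{a,b,c\}$. $Q_6$ on $\{a,b,c,d,e,f\}$: the only dependent 3-sets are $\{a,b,c\}$ and $\{a,d,e\}$ (two three-point lines meeting in a point). $R_6$ on $\{a,b,c,d,e,f\}$: the only dependent 3-sets are $\{a,b,c\}$ and $\{d,e,f\}$ (two disjoint three-point lines). $U_{r,m}$ denotes the uniform matroid of rank $r$ on $m$ elements. *)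

theory Defs
  imports Complex_Main
begin

record 'a indep_system =
  ground :: "'a set"
  indep :: "'a set set"

definition is_matroid :: "'a indep_system \<Rightarrow> bool" where
  "is_matroid M \<longleftrightarrow>
     finite (ground M) \<and>
     indep M \<subseteq> Pow (ground M) \<and>
     {} \<in> indep M \<and>
     (\<forall>I J. I \<in> indep M \<longrightarrow> J \<subseteq> I \<longrightarrow> J \<in> indep M) \<and>
     (\<forall>I J. I \<in> indep M \<longrightarrow> J \<in> indep M \<longrightarrow> card I < card J \<longrightarrow>
        (\<exists>x \<in> J - I. insert x I \<in> indep M))"

definition matroid_rank :: "'a indep_system \<Rightarrow> 'a set \<Rightarrow> nat" where
  "matroid_rank M X = Max (card ` {I \<in> indep M. I \<subseteq> X})"

definition delete :: "'a indep_system \<Rightarrow> 'a set \<Rightarrow> 'a indep_system" where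
  "delete M D = \<lparr>ground = ground M - D, indep = {I \<in> indep M. I \<subseteq> ground M - D}\<rparr>"

text \<open>The contraction of \<open>C\<close> is the matroid whose rank function is
  \<open>X \<mapsto> r (X \<union> C) - r C\<close>; a set is independent if this rank equals its cardinality.\<close>

definition contract :: "'a indep_system \<Rightarrow> 'a set \<Rightarrow> 'a indep_system" where
  "contract M C =
     \<lparr>ground = ground M - C,
      indep = {I. I \<subseteq> ground M - C \<and> matroid_rank M (I \<union> C) = card I + matroid_rank M C}\<rparr>"

definition is_minor :: "'a indep_system \<Rightarrow> 'a indep_system \<Rightarrow> bool" where
  "is_minor N M \<longleftrightarrow>
     (\<exists>C D. C \<subseteq> ground M \<and> D \<subseteq> ground M \<and> C \<inter> D = {} \<and> N = delete (contract M C) D)"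

definition matroid_iso :: "'a indep_system \<Rightarrow> 'b indep_system \<Rightarrow> bool" where
  "matroid_iso M N \<longleftrightarrow>
     (\<exists>f. bij_betw f (ground M) (ground N) \<and>
          (\<forall>X \<subseteq> ground M. X \<in> indep M \<longleftrightarrow> f ` X \<in> indep N))"

definition has_minor_iso :: "'a indep_system \<Rightarrow> 'b indep_system \<Rightarrow> bool" where
  "has_minor_iso M N \<longleftrightarrow> (\<exists>N'. is_minor N' M \<and> matroid_iso N' N)"

text \<open>Labelled matroids: distinct but isomorphic matroids on \<open>{1..n}\<close> are counted separately.\<close>

definition matroids_on :: "nat \<Rightarrow> nat indep_system set" where
  "matroids_on n = {M. is_matroid M \<and> ground M = {1..n}}"

definition uniform_matroid :: "nat \<Rightarrow> nat \<Rightarrow> nat indep_system" where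
  "uniform_matroid r m = \<lparr>ground = {1..m}, indep = {I. I \<subseteq> {1..m} \<and> card I \<le> r}\<rparr>"

text \<open>The bases of \<open>six_point L\<close> are the 3-subsets of \<open>{1..6}\<close> outside \<open>L\<close>.
  The elements \<open>a, b, c, d, e, f\<close> are named \<open>1, 2, 3, 4, 5, 6\<close>.\<close>

definition six_point :: "nat set set \<Rightarrow> nat indep_system" where
  "six_point L =
     \<lparr>ground = {1..6},
      indep = {I. \<exists>B. B \<subseteq> {1..6} \<and> card B = 3 \<and> B \<notin> L \<and> I \<subseteq> B}\<rparr>"

definition P6 :: "nat indep_system" where
  "P6 = six_point {{1, 2, 3}}"

definition Q6 :: "nat indep_system" where
  "Q6 = six_point {{1, 2, 3}, {1, 4, 5}}"

definition R6 :: "nat indep_system" where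
  "R6 = six_point {{1, 2, 3}, {4, 5, 6}}"

end

theory Submission
  imports Defs "HOL-Library.FuncSet" "HOL-Real_Asymp.Real_Asymp" "HOL-Number_Theory.Cong"
begin

text \<open>A matroid \<open>M\<close> of rank \<open>r\<close> is determined by the contractions \<open>M / S\<close>, where \<open>S\<close> runs through a family of
  \<open>(r - 3)\<close>-sets such that every \<open>r\<close>-set contains a member; with \<open>B = (n choose (n div 2))\<close>, the greedy
  algorithm finds such a family of size \<open>O(B log n / n\<^sup>3)\<close>. The lines with at least three points of a
  rank-3 contraction form a partial linear space. If two points each lie on many such lines, then
  \<open>M / S\<close> has the minor \<open>N\<close>. Hence if \<open>M\<close> has no minor \<open>N\<close>, all points of \<open>M / S\<close> but one lie on boundedly
  many lines, the number of lines is linear, and labelling the lines encodes \<open>M / S\<close> in \<open>O(n log n)\<close> bits.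
  So there are at most \<open>2 ^ O(B log\<^sup>2 n / n\<^sup>2)\<close> matroids without the minor \<open>N\<close>, whereas sparse paving matroids
  already give \<open>2 ^ (B / n)\<close> matroids.\<close>

section \<open>Partial linear spaces\<close>

text \<open>Rank three leaves very little room. Coding an arbitrary rank-3 matroid takes of order
  \<open>n^2 log n\<close> bits, as the count of Steiner triple systems shows. Over a cover of size
  \<open>B log n / n^3\<close> this gives the exponent \<open>B log^2 n / n\<close>, just too large
  against \<open>B / n\<close>. The missing minor must save almost a factor \<open>n\<close> per
  contraction, which a linear number of lines does.

  One rich point has to be tolerated. If all lines are three-point lines through one point, no two
  of them are disjoint and \<open>R6\<close> does not occur. If they are two disjoint long lines
  together with three-point lines joining them through a common point, any six of these points
  include three on a long line, so \<open>U_{3,6}\<close> does not occur. Hence the code gives one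
  point an unrestricted set of labels, which costs only linearly many bits.

  Six points are mostly chosen one at a time: at most five chosen points span at most ten lines, and
  the numerical thresholds only have to beat these ten lines.\<close>

lemma ex_subset_card: "n \<le> card A \<Longrightarrow> \<exists>B \<subseteq> A. card B = n"
  by (metis obtain_subset_with_card_n)

lemma card_le_oneI:
  assumes "\<And>p q. p \<in> A \<Longrightarrow> q \<in> A \<Longrightarrow> p = q"
  shows "card A \<le> 1"
proof (cases "A = {}")
  case False
  then obtain a where "a \<in> A" by blast
  then have "A = {a}" using assms by blast
  then show ?thesis by simp
qed simp

locale partial_linear_space =
  fixes P :: "'a set" and L :: "'a set set"
  assumes finite_points: "finite P"
    and line_subset: "l \<in> L \<Longrightarrow> l \<subseteq> P"
    and line_card: "l \<in> L \<Longrightarrow> 3 \<le> card l"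
    and line_unique: "\<lbrakk>l \<in> L; m \<in> L; a \<in> l; b \<in> l; a \<in> m; b \<in> m; a \<noteq> b\<rbrakk> \<Longrightarrow> l = m"
begin

section \<open>Collinearity patterns and points that leave them unchanged\<close>

definition traces :: "'a set \<Rightarrow> 'a set set" where
  "traces W = {l \<inter> W | l. l \<in> L \<and> 3 \<le> card (l \<inter> W)}"

text \<open>Equivalently, \<open>p\<close> lies outside \<open>W\<close> and on no line spanned by
  two points of \<open>W\<close>, so adding \<open>p\<close> to \<open>W\<close> creates no new
  collinear triple.\<close>

definition fresh :: "'a set \<Rightarrow> 'a \<Rightarrow> bool" where
  "fresh W p \<longleftrightarrow> p \<in> P - W \<and> (\<forall>l \<in> L. p \<in> l \<longrightarrow> card (l \<inter> W) \<le> 1)"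

definition spanned :: "'a set \<Rightarrow> 'a set set" where
  "spanned W = {l \<in> L. 2 \<le> card (l \<inter> W)}"

definition pencil :: "'a \<Rightarrow> 'a set set" where
  "pencil x = {l \<in> L. x \<in> l}"

lemma tracesI: "l \<in> L \<Longrightarrow> 3 \<le> card (l \<inter> W) \<Longrightarrow> l \<inter> W \<in> traces W"
  unfolding traces_def by blast

lemma finite_line: "l \<in> L \<Longrightarrow> finite l"
  using finite_points line_subset finite_subset by blast

lemma finite_lines: "finite L"
  using finite_points line_subset by (meson PowI finite_Pow_iff finite_subset subsetI)

lemma finite_pencil: "finite (pencil x)"
  using finite_lines unfolding pencil_def by simp

lemma line_eqI:
  assumes "l \<in> L" "m \<in> L" "2 \<le> card (l \<inter> m)"
  shows "l = m"
proof -
  obtain A where "A \<subseteq> l \<inter> m" "card A = 2"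
    using obtain_subset_with_card_n[OF assms(3)] by blast
  then obtain a b where "a \<in> l \<inter> m" "b \<in> l \<inter> m" "a \<noteq> b"
    by (auto simp: card_2_iff)
  then show ?thesis using line_unique assms by blast
qed

lemma card_line_Int: "l \<in> L \<Longrightarrow> m \<in> L \<Longrightarrow> l \<noteq> m \<Longrightarrow> card (l \<inter> m) \<le> 1"
  using line_eqI by fastforce

text \<open>A pair of points of \<open>W\<close> determines the line through it, and five points
  have \<open>5 choose 2 = 10\<close> pairs. Five is the largest size from which a six-point set
  still has to be extended.\<close>

lemma card_spanned:
  assumes "finite W" "card W \<le> 5"
  shows "card (spanned W) \<le> 10"
proof -
  define T where "T = {A. A \<subseteq> W \<and> card A = 2}"
  have fT: "finite T" unfolding T_def using assms(1) by simp
  have "\<exists>A\<in>T. A \<subseteq> l" if "l \<in> spanned W" for l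
  proof -
    from that have two: "2 \<le> card (l \<inter> W)" unfolding spanned_def by simp
    obtain A where "A \<subseteq> l \<inter> W" "card A = 2"
      using obtain_subset_with_card_n[OF two] by blast
    then show ?thesis unfolding T_def by blast
  qed
  then obtain g where g: "\<And>l. l \<in> spanned W \<Longrightarrow> g l \<in> T \<and> g l \<subseteq> l" by metis
  have "inj_on g (spanned W)"
  proof (rule inj_onI)
    fix l m assume lm: "l \<in> spanned W" "m \<in> spanned W" "g l = g m"
    then have "g l \<subseteq> l \<inter> m" "card (g l) = 2" "l \<in> L" "m \<in> L"
      using g[of l] g[of m] by (auto simp: T_def spanned_def)
    then have "2 \<le> card (l \<inter> m)" using finite_line by (metis card_mono finite_Int)
    then show "l = m" using line_eqI \<open>l \<in> L\<close> \<open>m \<in> L\<close> by blast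
  qed
  then have "card (spanned W) \<le> card T"
    using g fT by (meson card_inj_on_le image_subsetI)
  also have "\<dots> = card W choose 2" unfolding T_def using n_subsets[OF assms(1)] by simp
  also have "\<dots> \<le> 5 choose 2" using assms(2) by (rule binomial_right_mono)
  finally show ?thesis by (simp add: choose_two)
qed

text \<open>A point of \<open>Q\<close> that is not fresh lies in \<open>W\<close> or on one of the
  at most ten spanned lines. The candidate set \<open>Q\<close> is left open: later it consists of
  one point on each line of a pencil, or of the points of a long line.\<close>

lemma exists_fresh:
  assumes W: "finite W" "card W \<le> 5" and Q: "Q \<subseteq> P" "10 * s + 5 < card Q"
    and s: "\<And>l. l \<in> spanned W \<Longrightarrow> card (l \<inter> Q) \<le> s"
  shows "\<exists>p \<in> Q. fresh W p"
proof (rule ccontr)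
  assume "\<not> ?thesis"
  then have "Q \<subseteq> W \<union> (\<Union>l \<in> spanned W. l \<inter> Q)"
    using Q(1) unfolding fresh_def spanned_def by fastforce
  moreover have fs: "finite (spanned W)" unfolding spanned_def using finite_lines by simp
  moreover have fl: "finite (l \<inter> Q)" if "l \<in> spanned W" for l
    using that finite_line unfolding spanned_def by blast
  ultimately have "card Q \<le> card (W \<union> (\<Union>l \<in> spanned W. l \<inter> Q))"
    using W(1) by (intro card_mono finite_UnI finite_UN_I) blast+
  also have "\<dots> \<le> card W + card (\<Union>l \<in> spanned W. l \<inter> Q)" by (rule card_Un_le)
  also have "card (\<Union>l \<in> spanned W. l \<inter> Q) \<le> (\<Sum>l \<in> spanned W. card (l \<inter> Q))"
    by (rule card_UN_le[OF fs])
  also have "\<dots> \<le> card (spanned W) * s" using s sum_bounded_above[of "spanned W" _ s] by simp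
  also have "\<dots> \<le> 10 * s" using card_spanned[OF W] by simp
  finally show False using W Q by simp
qed

lemma traces_insert_fresh:
  assumes "fresh W p"
  shows "traces (insert p W) = traces W"
proof -
  have "l \<inter> insert p W = l \<inter> W" if "l \<in> L" "3 \<le> card (l \<inter> insert p W)" for l
  proof (rule ccontr)
    assume "\<not> ?thesis"
    then have "p \<in> l" by auto
    then have "card (l \<inter> W) \<le> 1" using assms that unfolding fresh_def by blast
    moreover have "card (l \<inter> insert p W) \<le> Suc (card (l \<inter> W))"
      using \<open>p \<in> l\<close> by (simp add: card_insert_le_m1 card_insert_if finite_line that(1))
    ultimately show False using that by simp
  qed
  moreover have "l \<inter> insert p W = l \<inter> W" if "l \<in> L" "3 \<le> card (l \<inter> W)" for l
    using that assms unfolding fresh_def by fastforce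
  ultimately have eq: "l \<inter> insert p W = l \<inter> W"
    if "l \<in> L" "3 \<le> card (l \<inter> insert p W) \<or> 3 \<le> card (l \<inter> W)" for l
    using that by blast
  then have "{l \<in> L. 3 \<le> card (l \<inter> insert p W)} = {l \<in> L. 3 \<le> card (l \<inter> W)}"
    by (intro Collect_cong) metis
  then have "(\<lambda>l. l \<inter> insert p W) ` {l \<in> L. 3 \<le> card (l \<inter> insert p W)} =
      (\<lambda>l. l \<inter> W) ` {l \<in> L. 3 \<le> card (l \<inter> W)}"
    using eq by (intro image_cong) simp_all
  then show ?thesis unfolding traces_def image_Collect by (simp only: conj_commute)
qed

text \<open>Reduces the search for six points to a smaller set \<open>W0\<close> that already has
  the wanted collinearities; fresh points then fill it up to size six.\<close>

lemma extend_fresh: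
  assumes step: "\<And>W. \<lbrakk>W \<subseteq> P; W0 \<subseteq> W; card W \<le> 5\<rbrakk> \<Longrightarrow> \<exists>p. fresh W p"
    and "W0 \<subseteq> P" "card W0 \<le> 6"
  shows "\<exists>W \<subseteq> P. card W = 6 \<and> traces W = traces W0"
proof -
  have "j \<le> 6 - card W0 \<Longrightarrow> \<exists>W \<subseteq> P. W0 \<subseteq> W \<and> card W = card W0 + j \<and> traces W = traces W0" for j
  proof (induction j)
    case 0 then show ?case using assms by auto
  next
    case (Suc j)
    then obtain W where W: "W \<subseteq> P" "W0 \<subseteq> W" "card W = card W0 + j" "traces W = traces W0" by auto
    then have "card W \<le> 5" using Suc.prems by simp
    then obtain p where p: "fresh W p" using step W by blast
    have "finite W" using W(1) finite_points finite_subset by blast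
    then have "card (insert p W) = card W0 + Suc j" using p W(3) unfolding fresh_def by simp
    moreover have "insert p W \<subseteq> P" using p W(1) unfolding fresh_def by simp
    moreover have "W0 \<subseteq> insert p W" using W(2) by blast
    moreover have "traces (insert p W) = traces W0" using W(4) traces_insert_fresh[OF p] by simp
    ultimately show ?case by (intro exI[of _ "insert p W"]) simp
  qed
  from this[of "6 - card W0"] show ?thesis using assms(3) by auto
qed

lemma traces_small:
  assumes "finite W" "card W \<le> 2"
  shows "traces W = {}"
proof -
  have "\<not> 3 \<le> card (l \<inter> W)" for l
    using card_mono[of W "l \<inter> W"] assms by simp
  then show ?thesis unfolding traces_def by simp
qed

lemma pencil_disjoint:
  assumes "l \<in> pencil x" "m \<in> pencil x" "p \<in> l" "p \<in> m" "p \<noteq> x"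
  shows "l = m"
  using assms line_unique unfolding pencil_def by blast

text \<open>Two lines through \<open>x\<close> share no other point, so choosing a point of
  \<open>Z\<close> other than \<open>x\<close> on each line is injective.\<close>

lemma card_pencil_meeting:
  assumes "finite Z"
  shows "card {l \<in> pencil x. \<exists>p \<in> l. p \<noteq> x \<and> p \<in> Z} \<le> card Z"
proof -
  let ?M = "{l \<in> pencil x. \<exists>p \<in> l. p \<noteq> x \<and> p \<in> Z}"
  define g where "g l = (SOME p. p \<in> l \<and> p \<noteq> x \<and> p \<in> Z)" for l
  have g: "g l \<in> l \<and> g l \<noteq> x \<and> g l \<in> Z" if "l \<in> ?M" for l
  proof -
    from that have "\<exists>p. p \<in> l \<and> p \<noteq> x \<and> p \<in> Z" by blast
    then show ?thesis unfolding g_def by (rule someI_ex)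
  qed
  have "inj_on g ?M"
  proof (rule inj_onI)
    fix l m assume "l \<in> ?M" "m \<in> ?M" "g l = g m"
    then show "l = m" using g[of l] g[of m] pencil_disjoint[of l x m "g l"] by simp
  qed
  then show ?thesis using g assms by (meson card_inj_on_le image_subsetI)
qed

lemma other_point:
  assumes "l \<in> L"
  shows "\<exists>u \<in> l. u \<noteq> a \<and> u \<noteq> b"
proof (rule ccontr)
  assume "\<not> ?thesis"
  then have "l \<subseteq> {a, b}" by blast
  then have "card l \<le> card {a, b}" by (intro card_mono) auto
  also have "\<dots> \<le> 2" by (simp add: card_insert_if)
  finally show False using line_card[OF assms] by simp
qed

text \<open>The candidates are one point on each line through \<open>x\<close>; every line contains few of them.\<close>

lemma exists_fresh_pencil:
  assumes no_transversal: "\<And>T. \<lbrakk>T \<in> L; x \<notin> T\<rbrakk> \<Longrightarrow> card {l \<in> pencil x. l \<inter> T \<noteq> {}} \<le> s"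
    and s: "1 \<le> s" "10 * s + 5 < card (pencil x)" and W: "finite W" "card W \<le> 5"
  shows "\<exists>p. fresh W p"
proof -
  have "\<exists>u \<in> l. u \<noteq> x" if "l \<in> pencil x" for l
    using other_point[of l x x] that unfolding pencil_def by auto
  then obtain q where q: "\<And>l. l \<in> pencil x \<Longrightarrow> q l \<in> l \<and> q l \<noteq> x" by metis
  define Q where "Q = q ` pencil x"
  have inj: "inj_on q (pencil x)" using q pencil_disjoint by (intro inj_onI) metis
  have "Q \<subseteq> P" using q line_subset unfolding Q_def pencil_def by blast
  moreover have "10 * s + 5 < card Q" unfolding Q_def using s inj by (simp add: card_image)
  moreover have "card (T \<inter> Q) \<le> s" if "T \<in> spanned W" for T
  proof (cases "x \<in> T")
    case True
    then have TL: "T \<in> L" "T \<in> pencil x" using that unfolding spanned_def pencil_def by auto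
    have "T \<inter> Q \<subseteq> {q T}" using q pencil_disjoint[OF _ TL(2)] unfolding Q_def by auto
    then have "card (T \<inter> Q) \<le> 1" using card_mono[of "{q T}"] by fastforce
    then show ?thesis using s by simp
  next
    case False
    then have TL: "T \<in> L" using that unfolding spanned_def by auto
    have "T \<inter> Q \<subseteq> q ` {l \<in> pencil x. l \<inter> T \<noteq> {}}" using q unfolding Q_def by auto
    then have "card (T \<inter> Q) \<le> card {l \<in> pencil x. l \<inter> T \<noteq> {}}"
      using finite_pencil[of x] by (intro surj_card_le[where f = q]) auto
    then show ?thesis using no_transversal[OF TL False] by simp
  qed
  ultimately show ?thesis using exists_fresh[OF W] by blast
qed

text \<open>A line \<open>T\<close> that crosses many lines of the pencil may block the search for
  fresh points. In that case \<open>T\<close> itself supplies the material: on six lines through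
  \<open>x\<close>, take the crossing point \<open>t i\<close> and one further point
  \<open>u i\<close>.\<close>

lemma transversal_points:
  assumes T: "T \<in> L" "x \<notin> T" and "6 \<le> card {l \<in> pencil x. l \<inter> T \<noteq> {}}"
  shows "\<exists>t u. inj_on t {..<6::nat} \<and>
    (\<forall>i<6. t i \<in> T \<and> u i \<notin> T \<and> u i \<noteq> x \<and> (\<exists>l \<in> pencil x. t i \<in> l \<and> u i \<in> l)) \<and>
    (\<forall>i<6. \<forall>j<6. \<forall>l \<in> L. i \<noteq> j \<longrightarrow> x \<in> l \<longrightarrow> \<not> (l \<inter> {t i, u i} \<noteq> {} \<and> l \<inter> {t j, u j} \<noteq> {}))"
proof -
  let ?M = "{l \<in> pencil x. l \<inter> T \<noteq> {}}"
  obtain M where M: "M \<subseteq> ?M" "card M = 6" "finite M"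
    using obtain_subset_with_card_n[OF assms(3)] by blast
  obtain h where h: "bij_betw h {..<6::nat} M"
    using M ex_bij_betw_nat_finite by (metis atLeast0LessThan)
  have hM: "h i \<in> ?M" if "i < 6" for i using h M that bij_betwE by blast
  have "\<exists>t. t \<in> h i \<and> t \<in> T" if "i < 6" for i using hM[OF that] by blast
  then obtain t where t: "\<And>i. i < 6 \<Longrightarrow> t i \<in> h i \<and> t i \<in> T" by metis
  have "\<exists>u \<in> h i. u \<noteq> x \<and> u \<noteq> t i" if "i < 6" for i
    using other_point[of "h i" x "t i"] hM[OF that] unfolding pencil_def by auto
  then obtain u where u: "\<And>i. i < 6 \<Longrightarrow> u i \<in> h i \<and> u i \<noteq> x \<and> u i \<noteq> t i" by metis
  have tx: "t i \<noteq> x" if "i < 6" for i using t[OF that] T(2) by auto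
  have hp: "h i \<in> pencil x" if "i < 6" for i using hM[OF that] by simp
  have on: "l = h i" if "i < 6" "l \<in> L" "x \<in> l" "l \<inter> {t i, u i} \<noteq> {}" for i l
    using that pencil_disjoint[of l x "h i"] t u tx hp unfolding pencil_def by blast
  have hinj: "h i \<noteq> h j" if "i < 6" "j < 6" "i \<noteq> j" for i j
    using h that unfolding bij_betw_def inj_on_def by auto
  have un: "u i \<notin> T" if "i < 6" for i
  proof
    assume "u i \<in> T"
    then have "T = h i"
      using line_unique[of T "h i" "t i" "u i"] T(1) t[OF that] u[OF that] hp[OF that]
      unfolding pencil_def by force
    then show False using hp[OF that] T(2) unfolding pencil_def by simp
  qed
  show ?thesis
  proof (rule exI[of _ t], rule exI[of _ u], intro conjI allI impI ballI)
    show "inj_on t {..<6}"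
    proof (rule inj_onI)
      fix i j :: nat assume "i \<in> {..<6}" "j \<in> {..<6}" "t i = t j"
      then show "i = j" using t hp tx hinj pencil_disjoint by (metis lessThan_iff)
    qed
    show "\<exists>l \<in> pencil x. t i \<in> l \<and> u i \<in> l" if "i < 6" for i
      using t[OF that] u[OF that] hp[OF that] by blast
    show "\<not> (l \<inter> {t i, u i} \<noteq> {} \<and> l \<inter> {t j, u j} \<noteq> {})"
      if "i < 6" "j < 6" "l \<in> L" "i \<noteq> j" "x \<in> l" for i j l
    proof
      assume "l \<inter> {t i, u i} \<noteq> {} \<and> l \<inter> {t j, u j} \<noteq> {}"
      then have "l = h i" "l = h j" using on that by auto
      then show False using hinj that by blast
    qed
  qed (use t u un in auto)
qed

lemma pencil_ex_avoiding:
  assumes "finite \<F>" "card \<F> < card (pencil x)"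
  shows "\<exists>l \<in> pencil x. l \<notin> \<F>"
  using assms by (metis card_mono leD subsetI)

section \<open>Six points in general position\<close>

lemma exists_fresh_on_line:
  assumes l: "l \<in> L" "m \<in> L" "l \<noteq> m" "18 \<le> card l"
    and W: "finite W" "card W \<le> 5" "card (l \<inter> W) \<le> 1"
  shows "\<exists>p \<in> l - m. fresh W p"
proof (rule exists_fresh[where s = 1])
  show "l - m \<subseteq> P" using line_subset l by blast
  have "card (l - m) = card l - card (l \<inter> m)" using finite_line[OF l(1)] by (simp add: card_Diff_subset_Int)
  \<comment> \<open>A line of 18 points keeps at least 17 outside \<open>m\<close>, which exceeds
    the 15 needed for \<open>s = 1\<close>.\<close>
  then show "10 * 1 + 5 < card (l - m)" using card_line_Int[OF l(1-3)] l(4) by simp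
  show "card (l' \<inter> (l - m)) \<le> 1" if "l' \<in> spanned W" for l'
  proof -
    from that have "l' \<in> L" "l' \<noteq> l" using W(3) unfolding spanned_def by auto
    then have "card (l' \<inter> l) \<le> 1" using card_line_Int l by blast
    moreover have "card (l' \<inter> (l - m)) \<le> card (l' \<inter> l)"
      using finite_line[OF l(1)] by (intro card_mono) auto
    ultimately show ?thesis by simp
  qed
qed (use W in auto)

text \<open>After the first new point, \<open>l\<close> meets the set in one point only, so
  \<open>l\<close> is still not spanned and a second fresh point exists on it. Avoiding
  \<open>m\<close> keeps \<open>m\<close> available for the next application.\<close>

lemma extend_by_two_on_line:
  assumes l: "l \<in> L" "m \<in> L" "l \<noteq> m" "18 \<le> card l"
    and W: "W \<subseteq> P" "card W \<le> 4" "l \<inter> W = {}"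
  obtains W' where "W' \<subseteq> P" "card W' = card W + 2" "traces W' = traces W" "m \<inter> W' = m \<inter> W"
proof -
  have fW: "finite W" using W(1) finite_points finite_subset by blast
  obtain p where p: "p \<in> l - m" "fresh W p"
    using exists_fresh_on_line[OF l fW] W by auto
  have cp: "card (insert p W) = Suc (card W)" using p fW unfolding fresh_def by simp
  have "l \<inter> insert p W = {p}" using p W(3) by auto
  then obtain q where q: "q \<in> l - m" "fresh (insert p W) q"
    using exists_fresh_on_line[OF l, of "insert p W"] W fW cp by auto
  have cq: "card (insert q (insert p W)) = card W + 2" using q fW cp unfolding fresh_def by simp
  show thesis
  proof (rule that[OF _ cq])
    show "insert q (insert p W) \<subseteq> P" using p q W(1) unfolding fresh_def by auto
    show "traces (insert q (insert p W)) = traces W"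
      using traces_insert_fresh[OF p(2)] traces_insert_fresh[OF q(2)] by simp
    show "m \<inter> insert q (insert p W) = m \<inter> W" using p q by auto
  qed
qed

text \<open>The six points are \<open>x\<close>, \<open>y\<close> and two points on each long line.
  The points taken on \<open>T1\<close> avoid \<open>T2\<close>, so the same step can be repeated
  with the two lines exchanged.\<close>

lemma generic_six_two_lines:
  assumes T: "T1 \<in> L" "T2 \<in> L" "T1 \<noteq> T2" "18 \<le> card T1" "18 \<le> card T2"
    and xy: "x \<in> P" "y \<in> P" "x \<noteq> y" "x \<notin> T1 \<union> T2" "y \<notin> T1 \<union> T2"
  shows "\<exists>W \<subseteq> P. card W = 6 \<and> traces W = {}"
proof -
  obtain W where W: "W \<subseteq> P" "card W = card {x, y} + 2" "traces W = traces {x, y}" "T2 \<inter> W = T2 \<inter> {x, y}"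
    using extend_by_two_on_line[of T1 T2 "{x, y}"] T xy by auto
  have "card W \<le> 4" "T2 \<inter> W = {}" using W xy by auto
  then obtain W' where W': "W' \<subseteq> P" "card W' = card W + 2" "traces W' = traces W"
    using extend_by_two_on_line[of T2 T1 W] T W(1) by metis
  have "traces {x, y} = {}" using xy by (intro traces_small) auto
  then show ?thesis using W W' xy by auto
qed

text \<open>Two points of \<open>T3\<close> outside \<open>T1\<close> and \<open>T2\<close> take the
  roles of \<open>x\<close> and \<open>y\<close>.\<close>

lemma generic_six_three_lines:
  assumes T: "T1 \<in> L" "T2 \<in> L" "T3 \<in> L" "T1 \<noteq> T2" "T1 \<noteq> T3" "T2 \<noteq> T3"
    and long: "18 \<le> card T1" "18 \<le> card T2" "18 \<le> card T3"
  shows "\<exists>W \<subseteq> P. card W = 6 \<and> traces W = {}"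
proof -
  have "card (T3 \<inter> (T1 \<union> T2)) \<le> card (T3 \<inter> T1) + card (T3 \<inter> T2)"
    by (metis Int_Un_distrib card_Un_le)
  also have "\<dots> \<le> 2" using card_line_Int[of T3 T1] card_line_Int[of T3 T2] T by fastforce
  finally have two: "2 \<le> card (T3 - (T1 \<union> T2))"
    using long(3) finite_line[OF T(3)] by (simp add: card_Diff_subset_Int)
  obtain S where S: "S \<subseteq> T3 - (T1 \<union> T2)" "card S = 2"
    using ex_subset_card[OF two] by blast
  from S(2) obtain x y where "S = {x, y}" "x \<noteq> y" by (auto simp: card_2_iff)
  then show ?thesis using generic_six_two_lines[of T1 T2 x y] T long S(1) line_subset[OF T(3)] by auto
qed

text \<open>A maximal subset of points in general position has at most five elements, so every other point
  lies on one of at most ten lines. If at most one long line avoided \<open>x\<close>, then almost every line through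
  \<open>x\<close> would need a point of its own on one of the short spanned lines.\<close>

lemma two_long_lines_avoiding:
  assumes no_generic: "\<not> (\<exists>W \<subseteq> P. card W = 6 \<and> traces W = {})" and x: "200 \<le> card (pencil x)"
  obtains (two) T1 T2 where "T1 \<in> L" "T2 \<in> L" "T1 \<noteq> T2" "18 \<le> card T1" "18 \<le> card T2" "x \<notin> T1" "x \<notin> T2"
proof (rule ccontr)
  assume neg: "\<not> thesis"
  define A where "A = {T \<in> L. 18 \<le> card T \<and> x \<notin> T}"
  have A1: "T = T'" if "T \<in> A" "T' \<in> A" for T T'
    using that neg two[of T T'] unfolding A_def by blast
  have "\<exists>W. W \<subseteq> P \<and> card W \<le> 5 \<and> (\<forall>p. \<not> fresh W p)"
  proof (rule ccontr)
    assume "\<not> ?thesis"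
    then have "\<exists>W \<subseteq> P. card W = 6 \<and> traces W = traces {}" by (intro extend_fresh) auto
    then show False using no_generic traces_small[of "{}"] by simp
  qed
  then obtain W where W: "W \<subseteq> P" "card W \<le> 5" and nf: "\<And>p. \<not> fresh W p" by blast
  have fW: "finite W" using W(1) finite_points finite_subset by blast
  define S where "S = {T \<in> spanned W. card T \<le> 17}"
  define Z where "Z = W \<union> \<Union>S"
  have fsp: "finite (spanned W)" unfolding spanned_def using finite_lines by simp
  have fS: "finite S" using fsp unfolding S_def by simp
  have "\<forall>T \<in> S. finite T" using finite_line unfolding S_def spanned_def by blast
  then have fZ: "finite Z" using fS fW unfolding Z_def by blast
  have "card (\<Union>S) \<le> (\<Sum>T \<in> S. card T)" by (rule card_Union_le_sum_card_weak) (use \<open>\<forall>T \<in> S. finite T\<close> in blast)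
  also have "\<dots> \<le> card S * 17" using sum_bounded_above[of S card 17] unfolding S_def by simp
  also have "card S \<le> card (spanned W)" using fsp unfolding S_def by (intro card_mono) auto
  also have "card (spanned W) \<le> 10" by (rule card_spanned[OF fW W(2)])
  finally have "card (\<Union>S) \<le> 170" by simp
  then have cZ: "card Z \<le> 175" unfolding Z_def using card_Un_le[of W "\<Union>S"] W(2) by simp
  have "\<exists>p \<in> l. p \<noteq> x \<and> p \<in> Z" if l: "l \<in> pencil x" "l \<notin> spanned W" for l
  proof -
    have lL: "l \<in> L" "x \<in> l" using l unfolding pencil_def by auto
    \<comment> \<open>At most one point of \<open>l\<close> is lost to the long line in
      \<open>A\<close>, and a third point remains besides it and \<open>x\<close>. Such a
      \<open>p\<close> outside \<open>W\<close> lies on a spanned line, which misses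
      \<open>x\<close> because \<open>l\<close> is not spanned, and which is therefore
      short.\<close>
    have "\<exists>p \<in> l. p \<noteq> x \<and> p \<notin> \<Union>A"
    proof (cases "A = {}")
      case True
      then show ?thesis using other_point[OF lL(1), of x x] by auto
    next
      case False
      then obtain T where T: "A = {T}" using A1 by blast
      then have "T \<in> L" "x \<notin> T" unfolding A_def by auto
      then have "card (l \<inter> T) \<le> 1" using card_line_Int lL by blast
      then obtain z where "l \<inter> T \<subseteq> {z}" using finite_line[OF lL(1)]
        by (metis card_1_singletonE card_0_eq empty_subsetI finite_Int le_neq_implies_less less_one subset_refl)
      then show ?thesis using other_point[OF lL(1), of x z] T by auto
    qed
    then obtain p where p: "p \<in> l" "p \<noteq> x" "p \<notin> \<Union>A" by blast
    have "p \<in> Z"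
    proof (cases "p \<in> W")
      case False
      then obtain T where T: "T \<in> L" "p \<in> T" "T \<in> spanned W"
        using nf[of p] p line_subset[OF lL(1)] unfolding fresh_def spanned_def by force
      then have "x \<notin> T" using l p pencil_disjoint[of l x T p] unfolding pencil_def by auto
      then have "card T \<le> 17" using p T unfolding A_def by force
      then show ?thesis using T unfolding Z_def S_def by blast
    qed (simp add: Z_def)
    then show ?thesis using p by blast
  qed
  then have "pencil x \<subseteq> spanned W \<union> {l \<in> pencil x. \<exists>p \<in> l. p \<noteq> x \<and> p \<in> Z}" by blast
  then have "card (pencil x) \<le> card (spanned W \<union> {l \<in> pencil x. \<exists>p \<in> l. p \<noteq> x \<and> p \<in> Z})"
    using fsp finite_pencil by (intro card_mono) auto
  also have "\<dots> \<le> card (spanned W) + card {l \<in> pencil x. \<exists>p \<in> l. p \<noteq> x \<and> p \<in> Z}" by (rule card_Un_le)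
  \<comment> \<open>Ten spanned lines, five points of \<open>W\<close> and ten short lines of at
    most 17 points give 185, which the round threshold 200 exceeds.\<close>
  also have "\<dots> \<le> 10 + 175" using card_spanned[OF fW W(2)] card_pencil_meeting[OF fZ, of x] cZ by simp
  finally show False using x by simp
qed

text \<open>If \<open>y\<close> misses the two long lines found for \<open>x\<close>, two lines
  suffice. Otherwise \<open>y\<close> lies on one of them, which is then neither of the two long
  lines avoiding \<open>y\<close>; so those two contribute a third long line.\<close>

lemma generic_six:
  assumes xy: "x \<in> P" "y \<in> P" "x \<noteq> y" "200 \<le> card (pencil x)" "200 \<le> card (pencil y)"
  shows "\<exists>W \<subseteq> P. card W = 6 \<and> traces W = {}"
proof (rule ccontr)
  assume neg: "\<not> ?thesis"
  obtain T1 T2 where T: "T1 \<in> L" "T2 \<in> L" "T1 \<noteq> T2" "18 \<le> card T1" "18 \<le> card T2" "x \<notin> T1" "x \<notin> T2"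
    using two_long_lines_avoiding[OF neg xy(4)] by blast
  obtain T3 T4 where T': "T3 \<in> L" "T4 \<in> L" "T3 \<noteq> T4" "18 \<le> card T3" "18 \<le> card T4" "y \<notin> T3" "y \<notin> T4"
    using two_long_lines_avoiding[OF neg xy(5)] by blast
  have "y \<in> T1 \<union> T2" using generic_six_two_lines[of T1 T2 x y] T xy neg by blast
  then have "(T3 \<noteq> T1 \<and> T3 \<noteq> T2) \<or> (T4 \<noteq> T1 \<and> T4 \<noteq> T2)" using T' by blast
  then show False using generic_six_three_lines[of T1 T2 T3] generic_six_three_lines[of T1 T2 T4] T T' neg
    by blast
qed

section \<open>Six points with one or two three-point lines\<close>

lemma traces_collinear:
  assumes "l \<in> L" "A \<subseteq> l" "card A = 3"
  shows "traces A = {A}"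
proof -
  have "finite A" using assms finite_line finite_subset by blast
  then have "m \<inter> A = A" if "3 \<le> card (m \<inter> A)" for m
    using that assms(3) by (metis card_seteq inf_le2)
  moreover have "l \<inter> A = A" using assms by blast
  ultimately have "S = A" if "S \<in> traces A" for S using that unfolding traces_def by auto
  moreover have "A \<in> traces A" using assms \<open>l \<inter> A = A\<close> using tracesI[of l A] by simp
  ultimately show ?thesis by blast
qed

text \<open>A third line meets \<open>A\<close> and \<open>B\<close> in at most one point each, so
  it never carries three points of the union. The last two hypotheses keep \<open>l1\<close> and
  \<open>l2\<close> from picking up points of the other triple.\<close>

lemma traces_two_lines:
  assumes l: "l1 \<in> L" "l2 \<in> L" "l1 \<noteq> l2"
    and AB: "A \<subseteq> l1" "card A = 3" "B \<subseteq> l2" "card B = 3" "l1 \<inter> B \<subseteq> A" "l2 \<inter> A \<subseteq> B"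
  shows "traces (A \<union> B) = {A, B}"
proof -
  have "l = l1 \<or> l = l2" if "l \<in> L" "3 \<le> card (l \<inter> (A \<union> B))" for l
  proof (rule ccontr)
    assume neg: "\<not> ?thesis"
    have "card (l \<inter> (A \<union> B)) \<le> card (l \<inter> A) + card (l \<inter> B)" by (metis Int_Un_distrib card_Un_le)
    also have "\<dots> \<le> card (l \<inter> l1) + card (l \<inter> l2)"
      using AB finite_line[OF that(1)] by (intro add_mono card_mono) auto
    also have "\<dots> \<le> 2" using card_line_Int[of l l1] card_line_Int[of l l2] neg that l by fastforce
    finally show False using that by simp
  qed
  moreover have i: "l1 \<inter> (A \<union> B) = A" "l2 \<inter> (A \<union> B) = B" using AB by auto
  ultimately have "S = A \<or> S = B" if "S \<in> traces (A \<union> B)" for S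
    using that unfolding traces_def by blast
  moreover have "l1 \<inter> (A \<union> B) \<in> traces (A \<union> B)" "l2 \<inter> (A \<union> B) \<in> traces (A \<union> B)"
    using tracesI[OF l(1), of "A \<union> B"] tracesI[OF l(2), of "A \<union> B"] AB i by simp_all
  ultimately show ?thesis unfolding i by blast
qed

text \<open>The line through \<open>a\<close> and \<open>b\<close> contains at most one
  \<open>t i\<close>: two of them would make it equal to \<open>T\<close>, which misses
  \<open>a\<close>. The indices 0 and 1 are left out because \<open>u 0\<close> and
  \<open>u 1\<close> later serve as \<open>a\<close> and \<open>b\<close>.\<close>

lemma transversal_points_off_line:
  assumes T: "T \<in> L" and t: "inj_on t {..<6::nat}" "\<And>i. i < 6 \<Longrightarrow> t i \<in> T"
    and ab: "a \<noteq> b" "a \<notin> T"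
  obtains I where "I \<subseteq> {2..<6}" "card I = 3" "\<And>i l. i \<in> I \<Longrightarrow> l \<in> L \<Longrightarrow> a \<in> l \<Longrightarrow> b \<in> l \<Longrightarrow> t i \<notin> l"
proof -
  let ?B = "{i \<in> {2..<6}. \<exists>l \<in> L. a \<in> l \<and> b \<in> l \<and> t i \<in> l}"
  have "i = j" if ij: "i \<in> ?B" "j \<in> ?B" for i j
  proof (rule ccontr)
    assume "i \<noteq> j"
    then have neq: "t i \<noteq> t j" using t(1) ij unfolding inj_on_def by auto
    obtain l m where lm: "l \<in> L" "a \<in> l" "b \<in> l" "t i \<in> l" "m \<in> L" "a \<in> m" "b \<in> m" "t j \<in> m"
      using ij by blast
    then have "l = m" using line_unique ab by blast
    moreover have "t i \<in> T" "t j \<in> T" using t(2) ij by auto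
    ultimately have "l = T" using line_unique[of l T "t i" "t j"] lm neq T by auto
    then show False using ab lm by simp
  qed
  then have "card ?B \<le> 1" by (rule card_le_oneI)
  then have three: "3 \<le> card ({2..<6} - ?B)" by (subst card_Diff_subset) auto
  obtain I where "I \<subseteq> {2..<6} - ?B" "card I = 3"
    using ex_subset_card[OF three] by blast
  then show thesis by (intro that[of I]) auto
qed

text \<open>If no line off \<open>x\<close> crosses six lines of the pencil, three points on a line
  through \<open>x\<close> extend by fresh points, since \<open>10 * 5 + 5 < 200\<close>. Otherwise
  take three points of a transversal \<open>T\<close> together with \<open>x\<close>,
  \<open>u 0\<close> and \<open>u 1\<close>. A line through \<open>x\<close> contains at most one of
  the other five. A line other than \<open>T\<close> that avoids \<open>x\<close> has at most one
  point on \<open>T\<close>, and none of the chosen ones if it contains both \<open>u 0\<close> and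
  \<open>u 1\<close>.\<close>

lemma six_with_one_line:
  assumes x: "x \<in> P" "200 \<le> card (pencil x)"
  shows "\<exists>W \<subseteq> P. card W = 6 \<and> (\<exists>A. card A = 3 \<and> traces W = {A})"
proof (cases "\<exists>T \<in> L. x \<notin> T \<and> 6 \<le> card {l \<in> pencil x. l \<inter> T \<noteq> {}}")
  case False
  then have nt: "card {l \<in> pencil x. l \<inter> T \<noteq> {}} \<le> 5" if "T \<in> L" "x \<notin> T" for T
    using that by force
  obtain l where l: "l \<in> pencil x" using pencil_ex_avoiding[of "{}" x] x by auto
  then have lL: "l \<in> L" unfolding pencil_def by simp
  obtain A where A: "A \<subseteq> l" "card A = 3" using obtain_subset_with_card_n[OF line_card[OF lL]] by blast
  have "\<exists>W \<subseteq> P. card W = 6 \<and> traces W = traces A"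
  proof (rule extend_fresh)
    show "\<exists>p. fresh W p" if "W \<subseteq> P" "A \<subseteq> W" "card W \<le> 5" for W
      using exists_fresh_pencil[OF nt] x that finite_subset[OF that(1) finite_points] by force
  qed (use A line_subset[OF lL] in auto)
  then show ?thesis using traces_collinear[OF lL A] A by auto
next
  case True
  then obtain T where T: "T \<in> L" "x \<notin> T" "6 \<le> card {l \<in> pencil x. l \<inter> T \<noteq> {}}" by blast
  obtain t u where tu0: "inj_on t {..<6::nat} \<and>
    (\<forall>i<6. t i \<in> T \<and> u i \<notin> T \<and> u i \<noteq> x \<and> (\<exists>l \<in> pencil x. t i \<in> l \<and> u i \<in> l)) \<and>
    (\<forall>i<6. \<forall>j<6. \<forall>l \<in> L. i \<noteq> j \<longrightarrow> x \<in> l \<longrightarrow> \<not> (l \<inter> {t i, u i} \<noteq> {} \<and> l \<inter> {t j, u j} \<noteq> {}))"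
    using transversal_points[OF T] by (elim exE)
  then have tu: "inj_on t {..<6::nat}" "\<And>i. i < 6 \<Longrightarrow> t i \<in> T"
    "\<And>i. i < 6 \<Longrightarrow> u i \<notin> T" "\<And>i. i < 6 \<Longrightarrow> u i \<noteq> x"
    "\<And>i. i < 6 \<Longrightarrow> \<exists>l \<in> pencil x. t i \<in> l \<and> u i \<in> l"
    "\<And>i j l. \<lbrakk>i < 6; j < 6; i \<noteq> j; l \<in> L; x \<in> l\<rbrakk> \<Longrightarrow> \<not> (l \<inter> {t i, u i} \<noteq> {} \<and> l \<inter> {t j, u j} \<noteq> {})"
    by auto
  have u_neq: "u i \<noteq> u j" if "i < 6" "j < 6" "i \<noteq> j" for i j
  proof -
    obtain l where "l \<in> pencil x" "u i \<in> l" using tu(5)[OF \<open>i < 6\<close>] by blast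
    then show ?thesis using tu(6)[OF that, of l] unfolding pencil_def by auto
  qed
  then have u01: "u 0 \<noteq> u 1" by simp
  obtain I where I: "I \<subseteq> {2..<6}" "card I = 3"
    "\<And>i l. i \<in> I \<Longrightarrow> l \<in> L \<Longrightarrow> u 0 \<in> l \<Longrightarrow> u 1 \<in> l \<Longrightarrow> t i \<notin> l"
    using transversal_points_off_line[OF T(1) tu(1,2) u01 tu(3)[of 0]] by auto
  define A where "A = t ` I"
  have I6: "i < 6" "2 \<le> i" if "i \<in> I" for i using that I(1) by auto
  have AT: "A \<subseteq> T" using tu(2) I6 unfolding A_def by auto
  have cA: "card A = 3" unfolding A_def using I(2)
    by (subst card_image) (auto intro: inj_on_subset[OF tu(1)] I6)
  have fA: "finite A" using cA card.infinite by fastforce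
  let ?W = "A \<union> {x, u 0, u 1}"
  have off: "A \<inter> {x, u 0, u 1} = {}" using AT T(2) tu(3) by auto
  have c3: "card {x, u 0, u 1} = 3" using tu(4)[of 0] tu(4)[of 1] u01 by auto
  have cW: "card ?W = 6" using card_Un_disjoint[OF fA _ off] cA c3 by simp
  have uP: "u i \<in> P" if "i < 6" for i using tu(5)[OF that] line_subset unfolding pencil_def by blast
  have "A \<subseteq> P" using AT line_subset[OF T(1)] by (rule subset_trans)
  then have WP: "?W \<subseteq> P" using uP[of 0] uP[of 1] x(1) by simp
  have small: "card (l \<inter> ?W) \<le> 2" if l: "l \<in> L" "l \<noteq> T" for l
  proof (cases "x \<in> l")
    case True
    \<comment> \<open>\<open>e\<close> picks one element from each pair \<open>{t i, u i}\<close>,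
      so the separation of pairs by lines through \<open>x\<close> applies to all five points at
      once.\<close>
    define e where "e i = (if i \<in> I then t i else u i)" for i
    have sub: "A \<union> {u 0, u 1} \<subseteq> e ` (I \<union> {0, 1})"
    proof -
      have "0 \<notin> I" "1 \<notin> I" using I6(2) by fastforce+
      then show ?thesis unfolding A_def e_def by auto
    qed
    have inj: "e i = e j" if "i \<in> I \<union> {0, 1}" "j \<in> I \<union> {0, 1}" "e i \<in> l" "e j \<in> l" for i j
    proof (rule ccontr)
      assume "e i \<noteq> e j"
      then have "i \<noteq> j" by blast
      moreover have "i < 6" "j < 6" using that I6(1) by auto
      ultimately show False using tu(6)[of i j l] that(3,4) l(1) True unfolding e_def
        by (simp split: if_splits)
    qed
    have "p = q" if pq: "p \<in> l \<inter> (A \<union> {u 0, u 1})" "q \<in> l \<inter> (A \<union> {u 0, u 1})" for p q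
    proof -
      have "p \<in> e ` (I \<union> {0, 1})" "q \<in> e ` (I \<union> {0, 1})" using pq sub by blast+
      then obtain i j where "i \<in> I \<union> {0, 1}" "j \<in> I \<union> {0, 1}" "p = e i" "q = e j" by (elim imageE)
      then show ?thesis using inj[of i j] pq by simp
    qed
    then have "card (l \<inter> (A \<union> {u 0, u 1})) \<le> 1" by (rule card_le_oneI)
    moreover have "l \<inter> ?W = insert x (l \<inter> (A \<union> {u 0, u 1}))" using True by auto
    ultimately show ?thesis using fA by (simp add: card_insert_if)
  next
    case False
    have "card (l \<inter> A) \<le> card (l \<inter> T)"
      using AT finite_line[OF l(1)] by (intro card_mono) auto
    then have lA: "card (l \<inter> A) \<le> 1" using card_line_Int[OF l(1) T(1) l(2)] by simp
    show ?thesis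
    proof (cases "u 0 \<in> l \<and> u 1 \<in> l")
      case True
      then have "l \<inter> ?W \<subseteq> {u 0, u 1}" using I(3) l(1) False unfolding A_def by auto
      then have "card (l \<inter> ?W) \<le> card {u 0, u 1}" by (intro card_mono) auto
      then show ?thesis using u01 by simp
    next
      case nb: False
      have "l \<inter> ?W \<subseteq> (l \<inter> A) \<union> (if u 0 \<in> l then {u 0} else {u 1})" using False nb by auto
      then have "card (l \<inter> ?W) \<le> card ((l \<inter> A) \<union> (if u 0 \<in> l then {u 0} else {u 1}))"
        using fA by (intro card_mono) auto
      also have "\<dots> \<le> card (l \<inter> A) + 1"
        using card_Un_le[of "l \<inter> A" "if u 0 \<in> l then {u 0} else {u 1}"] by (simp split: if_splits)
      finally show ?thesis using lA by simp
    qed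
  qed
  have TW: "T \<inter> ?W = A" using AT T(2) tu(3)[of 0] tu(3)[of 1] by auto
  have "traces ?W = {A}"
  proof (intro equalityI subsetI)
    fix S assume "S \<in> traces ?W"
    then obtain l where l: "l \<in> L" "S = l \<inter> ?W" "3 \<le> card (l \<inter> ?W)" unfolding traces_def by blast
    then have "l = T" using small[of l] by fastforce
    then show "S \<in> {A}" using l(2) TW by simp
  next
    fix S assume "S \<in> {A}"
    then show "S \<in> traces ?W" using tracesI[OF T(1), of ?W] TW cA by simp
  qed
  then show ?thesis using WP cW cA by blast
qed

lemma two_meeting_linesI:
  assumes "W \<subseteq> P" "card W = 6" "card A = 3" "card B = 3" "card (A \<inter> B) = 1" "traces W = {A, B}"
  shows "\<exists>W \<subseteq> P. card W = 6 \<and> (\<exists>A B. card A = 3 \<and> card B = 3 \<and> card (A \<inter> B) = 1 \<and> traces W = {A, B})"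
  by (rule exI[of _ W], intro conjI assms(1,2), rule exI[of _ A], rule exI[of _ B], intro conjI assms(3-6))

text \<open>Without a transversal, two lines through \<open>x\<close> give five points, and a fresh
  point completes them. With a transversal \<open>T\<close>, the two lines meet in
  \<open>t 0\<close> instead: one is \<open>T\<close>, the other is the line through
  \<open>x\<close>, \<open>t 0\<close> and \<open>u 0\<close>. The sixth point \<open>u 1\<close> is
  shown to be fresh by asking whether a line through it contains \<open>x\<close> or
  \<open>u 0\<close>; if it contains neither, all its points in the set lie on
  \<open>T\<close>.\<close>

lemma six_with_two_meeting_lines:
  assumes x: "x \<in> P" "200 \<le> card (pencil x)"
  shows "\<exists>W \<subseteq> P. card W = 6 \<and> (\<exists>A B. card A = 3 \<and> card B = 3 \<and> card (A \<inter> B) = 1 \<and> traces W = {A, B})"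
proof (cases "\<exists>T \<in> L. x \<notin> T \<and> 6 \<le> card {l \<in> pencil x. l \<inter> T \<noteq> {}}")
  case False
  then have nt: "card {l \<in> pencil x. l \<inter> T \<noteq> {}} \<le> 5" if "T \<in> L" "x \<notin> T" for T
    using that by force
  obtain l1 where l1: "l1 \<in> pencil x" using pencil_ex_avoiding[of "{}" x] x by auto
  obtain l2 where l2: "l2 \<in> pencil x" "l2 \<noteq> l1" using pencil_ex_avoiding[of "{l1}" x] x by auto
  have lL: "l1 \<in> L" "l2 \<in> L" "x \<in> l1" "x \<in> l2" using l1 l2 unfolding pencil_def by auto
  have meet: "p = x" if "p \<in> l1" "p \<in> l2" for p using pencil_disjoint[OF l1 l2(1)] that l2(2) by blast
  have triple: "\<exists>A \<subseteq> l. x \<in> A \<and> card A = 3" if l: "l \<in> L" "x \<in> l" for l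
  proof -
    obtain b where b: "b \<in> l" "b \<noteq> x" using other_point[OF l(1), of x x] by auto
    obtain c where "c \<in> l" "c \<noteq> x" "c \<noteq> b" using other_point[OF l(1), of x b] by auto
    then show ?thesis using b l by (intro exI[of _ "{x, b, c}"]) auto
  qed
  obtain A where A: "A \<subseteq> l1" "x \<in> A" "card A = 3" using triple lL by blast
  obtain B where B: "B \<subseteq> l2" "x \<in> B" "card B = 3" using triple lL by blast
  have "l1 \<inter> l2 \<subseteq> {x}" using meet by blast
  then have "l1 \<inter> B \<subseteq> {x}" "l2 \<inter> A \<subseteq> {x}" using A(1) B(1) by blast+
  then have AB: "A \<inter> B = {x}" "l1 \<inter> B \<subseteq> A" "l2 \<inter> A \<subseteq> B" using A B by blast+
  have tr: "traces (A \<union> B) = {A, B}"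
    using traces_two_lines[OF lL(1,2) l2(2)[symmetric] A(1,3) B(1,3) AB(2,3)] .
  have fin: "finite A" "finite B" using A B finite_line lL finite_subset by blast+
  have "card (A \<union> B) = 5" using card_Un_Int[OF fin] A(3) B(3) AB(1) by simp
  then have "\<exists>W \<subseteq> P. card W = 6 \<and> traces W = traces (A \<union> B)"
    using A(1) B(1) line_subset lL
  proof (intro extend_fresh)
    show "\<exists>p. fresh W p" if "W \<subseteq> P" "A \<union> B \<subseteq> W" "card W \<le> 5" for W
      using exists_fresh_pencil[OF nt] x that finite_subset[OF that(1) finite_points] by force
  qed auto
  then obtain W where W: "W \<subseteq> P" "card W = 6" "traces W = {A, B}" unfolding tr by (elim exE conjE)
  have "card (A \<inter> B) = 1" using AB(1) by simp
  then show ?thesis using two_meeting_linesI[OF W(1,2) A(3) B(3) _ W(3)] by simp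
next
  case True
  then obtain T where T: "T \<in> L" "x \<notin> T" "6 \<le> card {l \<in> pencil x. l \<inter> T \<noteq> {}}" by blast
  obtain t u where tu0: "inj_on t {..<6::nat} \<and>
    (\<forall>i<6. t i \<in> T \<and> u i \<notin> T \<and> u i \<noteq> x \<and> (\<exists>l \<in> pencil x. t i \<in> l \<and> u i \<in> l)) \<and>
    (\<forall>i<6. \<forall>j<6. \<forall>l \<in> L. i \<noteq> j \<longrightarrow> x \<in> l \<longrightarrow> \<not> (l \<inter> {t i, u i} \<noteq> {} \<and> l \<inter> {t j, u j} \<noteq> {}))"
    using transversal_points[OF T] by (elim exE)
  then have tu: "inj_on t {..<6::nat}" "\<And>i. i < 6 \<Longrightarrow> t i \<in> T"
    "\<And>i. i < 6 \<Longrightarrow> u i \<notin> T" "\<And>i. i < 6 \<Longrightarrow> u i \<noteq> x"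
    "\<And>i. i < 6 \<Longrightarrow> \<exists>l \<in> pencil x. t i \<in> l \<and> u i \<in> l"
    "\<And>i j l. \<lbrakk>i < 6; j < 6; i \<noteq> j; l \<in> L; x \<in> l\<rbrakk> \<Longrightarrow> \<not> (l \<inter> {t i, u i} \<noteq> {} \<and> l \<inter> {t j, u j} \<noteq> {})"
    by auto
  have u_neq: "u i \<noteq> u j" if "i < 6" "j < 6" "i \<noteq> j" for i j
  proof -
    obtain l where "l \<in> pencil x" "u i \<in> l" using tu(5)[OF \<open>i < 6\<close>] by blast
    then show ?thesis using tu(6)[OF that, of l] unfolding pencil_def by auto
  qed
  then have u01: "u 0 \<noteq> u 1" by simp
  obtain I where I: "I \<subseteq> {2..<6}" "card I = 3"
    "\<And>i l. i \<in> I \<Longrightarrow> l \<in> L \<Longrightarrow> u 0 \<in> l \<Longrightarrow> u 1 \<in> l \<Longrightarrow> t i \<notin> l"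
    using transversal_points_off_line[OF T(1) tu(1,2) u01 tu(3)[of 0]] by auto
  have two: "2 \<le> card I" using I(2) by simp
  obtain J where J: "J \<subseteq> I" "card J = 2" using ex_subset_card[OF two] by blast
  from J(2) obtain i j where ij: "J = {i, j}" "i \<noteq> j" by (auto simp: card_2_iff)
  have iI: "i \<in> I" "j \<in> I" using J ij by auto
  have i6: "i < 6" "2 \<le> i" "j < 6" "2 \<le> j" using iI I(1) by auto
  obtain l0 where l0: "l0 \<in> pencil x" "t 0 \<in> l0" "u 0 \<in> l0" using tu(5)[of 0] by auto
  then have l0L: "l0 \<in> L" "x \<in> l0" "l0 \<noteq> T" using T(2) unfolding pencil_def by auto
  define A where "A = {t 0, x, u 0}"
  define B where "B = {t 0, t i, t j}"
  have tx: "t k \<noteq> x" "t k \<noteq> u m" if "k < 6" "m < 6" for k m using tu(2,3) that T(2) by metis+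
  have tinj: "t 0 \<noteq> t i" "t 0 \<noteq> t j" "t i \<noteq> t j" using tu(1) i6 ij(2) unfolding inj_on_def by fastforce+
  have cA: "card A = 3" unfolding A_def using tx[of 0 0] tu(4)[of 0] by auto
  have cB: "card B = 3" unfolding B_def using tinj by auto
  have AB: "A \<inter> B = {t 0}" unfolding A_def B_def using tx i6 by auto
  have tl0: "t i \<notin> l0" "t j \<notin> l0" using tu(6)[of 0 i l0] tu(6)[of 0 j l0] l0 l0L i6 by auto
  have tr: "traces (A \<union> B) = {A, B}"
  proof (rule traces_two_lines[OF l0L(1) T(1) l0L(3) _ cA _ cB])
    show "A \<subseteq> l0" "B \<subseteq> T" using l0 l0L tu(2) i6 unfolding A_def B_def by auto
    show "l0 \<inter> B \<subseteq> A" using tl0 unfolding A_def B_def by auto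
    show "T \<inter> A \<subseteq> B" using T(2) tu(3)[of 0] unfolding A_def B_def by auto
  qed
  have AL: "A \<subseteq> l0" "B \<subseteq> T" using l0 l0L tu(2) i6 unfolding A_def B_def by auto
  have fin: "finite A" "finite B" unfolding A_def B_def by auto
  have c5: "card (A \<union> B) = 5" using card_Un_Int[OF fin] cA cB AB by simp
  have ul0: "u 1 \<notin> l0" using tu(6)[of 0 1 l0] l0 l0L by auto
  have fr: "fresh (A \<union> B) (u 1)"
    unfolding fresh_def
  proof (intro conjI ballI impI)
    show "u 1 \<in> P - (A \<union> B)"
      using tu(5)[of 1] line_subset ul0 AL tu(3)[of 1] unfolding pencil_def by auto
    fix l assume l: "l \<in> L" "u 1 \<in> l"
    show "card (l \<inter> (A \<union> B)) \<le> 1"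
    proof (cases "x \<in> l")
      case True
      then have "l \<inter> (A \<union> B) \<subseteq> {x}"
        using tu(6)[of 1 0 l] tu(6)[of 1 i l] tu(6)[of 1 j l] l i6 unfolding A_def B_def by auto
      then show ?thesis using card_mono[of "{x}"] by fastforce
    next
      case False
      show ?thesis
      proof (cases "u 0 \<in> l")
        case True
        \<comment> \<open>Sharing \<open>t 0\<close> and \<open>u 0\<close> would force
          \<open>l = l0\<close>, and \<open>l0\<close> contains \<open>x\<close>.\<close>
        have "t 0 \<notin> l" using line_unique[of l l0 "t 0" "u 0"] l l0 l0L True False tx[of 0 0] by auto
        then have "l \<inter> (A \<union> B) \<subseteq> {u 0}"
          using True False I(3)[OF iI(1)] I(3)[OF iI(2)] l unfolding A_def B_def by auto
        then show ?thesis using card_mono[of "{u 0}"] by fastforce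
      next
        case nu: False
        have "l \<noteq> T" using l tu(3)[of 1] by auto
        then have "card (l \<inter> T) \<le> 1" using card_line_Int l T by blast
        moreover have "l \<inter> (A \<union> B) \<subseteq> l \<inter> T" using False nu AL(2) unfolding A_def B_def by auto
        then have "card (l \<inter> (A \<union> B)) \<le> card (l \<inter> T)"
          using finite_line[OF l(1)] by (intro card_mono) auto
        ultimately show ?thesis by simp
      qed
    qed
  qed
  let ?W = "insert (u 1) (A \<union> B)"
  have "A \<union> B \<subseteq> P" using AL line_subset[OF l0L(1)] line_subset[OF T(1)] by blast
  then have W: "?W \<subseteq> P" using fr unfolding fresh_def by simp
  have W6: "card ?W = 6" using c5 fin fr unfolding fresh_def by simp
  have trW: "traces ?W = {A, B}" using traces_insert_fresh[OF fr] tr by simp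
  have "card (A \<inter> B) = 1" using AB by simp
  then show ?thesis using two_meeting_linesI[OF W W6 cA cB _ trW] by simp
qed

text \<open>A line through \<open>x\<close> and a line through \<open>y\<close> may share a point.
  If both have at least four points, dropping the shared point leaves a triple on each. If one has
  exactly three, it is instead paired with a line through the other rich point that is disjoint from
  it.\<close>

lemma two_disjoint_triples:
  assumes xy: "x \<noteq> y" "200 \<le> card (pencil x)" "200 \<le> card (pencil y)"
  obtains (triples) l1 l2 A B where "l1 \<in> L" "l2 \<in> L" "l1 \<noteq> l2" "A \<subseteq> l1 - l2" "B \<subseteq> l2 - l1" "card A = 3" "card B = 3"
proof -
  have short: thesis
    if xy': "x \<noteq> y" "200 \<le> card (pencil y)" and l1: "l1 \<in> L" "y \<notin> l1" "card l1 = 3" for x y l1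
  proof -
    \<comment> \<open>The three points of \<open>l1\<close> can block at most three of the many
      lines through \<open>y\<close>.\<close>
    have "card {l \<in> pencil y. \<exists>p \<in> l. p \<noteq> y \<and> p \<in> l1} \<le> 3"
      using card_pencil_meeting[OF finite_line[OF l1(1)], of y] l1(3) by simp
    then obtain l2 where l2: "l2 \<in> pencil y" "\<not> (\<exists>p \<in> l2. p \<noteq> y \<and> p \<in> l1)"
      using pencil_ex_avoiding[of "{l \<in> pencil y. \<exists>p \<in> l. p \<noteq> y \<and> p \<in> l1}" y] finite_pencil[of y] xy'
      by auto
    then have dis: "l1 \<inter> l2 = {}" using l1 by auto
    have L2: "l2 \<in> L" using l2 unfolding pencil_def by simp
    obtain B where "B \<subseteq> l2" "card B = 3" using obtain_subset_with_card_n[OF line_card[OF L2]] by blast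
    then show thesis using triples[of l1 l2 l1 B] l1 L2 dis l2 unfolding pencil_def by blast
  qed
  have ex: "\<exists>l \<in> L. x \<in> l \<and> y \<notin> l" if xy': "x \<noteq> y" "200 \<le> card (pencil x)" for x y
  proof -
    have "card {l \<in> pencil x. \<exists>p \<in> l. p \<noteq> x \<and> p \<in> {y}} \<le> 1"
      using card_pencil_meeting[of "{y}" x] by simp
    then obtain l where "l \<in> pencil x" "\<not> (\<exists>p \<in> l. p \<noteq> x \<and> p \<in> {y})"
      using pencil_ex_avoiding[of "{l \<in> pencil x. \<exists>p \<in> l. p \<noteq> x \<and> p \<in> {y}}" x] finite_pencil[of x] xy'
      by auto
    then show ?thesis using xy'(1) unfolding pencil_def by auto
  qed
  obtain l1 where l1: "l1 \<in> L" "x \<in> l1" "y \<notin> l1" using ex[of x y] xy by auto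
  obtain l2 where l2: "l2 \<in> L" "y \<in> l2" "x \<notin> l2" using ex[of y x] xy by auto
  show thesis
  proof (cases "card l1 = 3 \<or> card l2 = 3")
    case True
    then show thesis using short[of x y l1] short[of y x l2] l1 l2 xy by auto
  next
    case False
    then have four: "4 \<le> card l1" "4 \<le> card l2" using line_card[OF l1(1)] line_card[OF l2(1)] by auto
    have neq: "l1 \<noteq> l2" using l1 l2 by auto
    have three: "3 \<le> card (l1 - l2)" "3 \<le> card (l2 - l1)"
      using four card_line_Int[of l1 l2] card_line_Int[of l2 l1] l1 l2 neq finite_line[of l1] finite_line[of l2]
      by (simp_all add: card_Diff_subset_Int)
    obtain A B where "A \<subseteq> l1 - l2" "card A = 3" "B \<subseteq> l2 - l1" "card B = 3"
      using ex_subset_card[OF three(1)] ex_subset_card[OF three(2)] by blast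
    then show thesis using triples[of l1 l2 A B] l1 l2 neq by blast
  qed
qed

lemma six_with_two_disjoint_lines:
  assumes "x \<noteq> y" "200 \<le> card (pencil x)" "200 \<le> card (pencil y)"
  shows "\<exists>W \<subseteq> P. card W = 6 \<and> (\<exists>A B. card A = 3 \<and> card B = 3 \<and> A \<inter> B = {} \<and> traces W = {A, B})"
proof -
  obtain l1 l2 A B where AB: "l1 \<in> L" "l2 \<in> L" "l1 \<noteq> l2" "A \<subseteq> l1 - l2" "B \<subseteq> l2 - l1" "card A = 3" "card B = 3"
    by (rule two_disjoint_triples[OF assms])
  have sub: "A \<subseteq> l1" "B \<subseteq> l2" "l1 \<inter> B \<subseteq> A" "l2 \<inter> A \<subseteq> B" "A \<inter> B = {}" using AB(4,5) by blast+
  have "traces (A \<union> B) = {A, B}"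
    by (rule traces_two_lines[OF AB(1-3) sub(1) AB(6) sub(2) AB(7) sub(3,4)])
  moreover have "finite A" "finite B" using AB(6,7) by (auto intro: card_ge_0_finite)
  then have "card (A \<union> B) = 6" using card_Un_disjoint[of A B] AB(6,7) sub(5) by simp
  moreover have "A \<union> B \<subseteq> P" using sub(1,2) line_subset[OF AB(1)] line_subset[OF AB(2)] by blast
  ultimately have W: "A \<union> B \<subseteq> P" "card (A \<union> B) = 6" "traces (A \<union> B) = {A, B}" by simp_all
  show ?thesis
    by (rule exI[of _ "A \<union> B"], intro conjI W(1,2), rule exI[of _ A], rule exI[of _ B], intro conjI AB(6,7) sub(5) W(3))
qed

end

section \<open>Matroids of rank at most three\<close>

text \<open>\<open>J\<close> is the family of independent sets. Contractions produce loops and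
  parallel elements, so both are allowed, and the rank is only bounded above.\<close>

locale rank3_matroid =
  fixes n :: nat and J :: "nat set set"
  assumes J_subset: "I \<in> J \<Longrightarrow> I \<subseteq> {1..n}"
    and J_empty: "{} \<in> J"
    and J_down: "I \<in> J \<Longrightarrow> I' \<subseteq> I \<Longrightarrow> I' \<in> J"
    and J_exchange: "I \<in> J \<Longrightarrow> I' \<in> J \<Longrightarrow> card I < card I' \<Longrightarrow> \<exists>x \<in> I' - I. insert x I \<in> J"
    and J_card: "I \<in> J \<Longrightarrow> card I \<le> 3"
begin

section \<open>Simplification: parallel classes and their representatives\<close>

definition parallel :: "nat \<Rightarrow> nat \<Rightarrow> bool" where
  "parallel v w \<longleftrightarrow> v = w \<or> {v, w} \<notin> J"

text \<open>Loops are sent to the junk value 0, which is not an element of the ground set.\<close>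

definition rep :: "nat \<Rightarrow> nat" where
  "rep v = (if {v} \<in> J then LEAST w. {w} \<in> J \<and> parallel v w else 0)"

definition points :: "nat set" where
  "points = rep ` {v. {v} \<in> J}"

definition span2 :: "nat \<Rightarrow> nat \<Rightarrow> nat set" where
  "span2 a b = {c \<in> points. c = a \<or> c = b \<or> {a, b, c} \<notin> J}"

definition lines :: "nat set set" where
  "lines = {l. \<exists>a \<in> points. \<exists>b \<in> points. a \<noteq> b \<and> l = span2 a b \<and> 3 \<le> card l}"

lemma J_finite: "I \<in> J \<Longrightarrow> finite I"
  using J_subset finite_subset by blast

lemma augment:
  assumes "I \<in> J" "B \<in> J" "card I \<le> card B"
  shows "\<exists>I' \<in> J. I \<subseteq> I' \<and> I' \<subseteq> I \<union> B \<and> card I' = card B"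
proof -
  have "card I + j \<le> card B \<Longrightarrow> \<exists>I' \<in> J. I \<subseteq> I' \<and> I' \<subseteq> I \<union> B \<and> card I' = card I + j" for j
  proof (induction j)
    case 0 then show ?case using assms by auto
  next
    case (Suc j)
    then obtain I' where I': "I' \<in> J" "I \<subseteq> I'" "I' \<subseteq> I \<union> B" "card I' = card I + j" by auto
    then obtain x where x: "x \<in> B - I'" "insert x I' \<in> J"
      using J_exchange[of I' B] assms Suc.prems by auto
    have "card (insert x I') = card I + Suc j" using x I' J_finite by simp
    then show ?case using x I' by (intro bexI[of _ "insert x I'"]) auto
  qed
  from this[of "card B - card I"] show ?thesis using assms(3) by auto
qed

lemma parallel_sym: "parallel v w \<Longrightarrow> parallel w v"
  unfolding parallel_def by (metis insert_commute)

text \<open>A loop is \<open>parallel\<close> to everything, so transitivity can only pass through a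
  non-loop \<open>w\<close>. For such \<open>w\<close>, an independent pair \<open>{v, z}\<close>
  would augment \<open>{w}\<close> by \<open>v\<close> or \<open>z\<close>.\<close>

lemma parallel_trans:
  assumes "{w} \<in> J" "parallel v w" "parallel w z"
  shows "parallel v z"
proof (rule ccontr)
  assume neg: "\<not> parallel v z"
  then have vz: "v \<noteq> z" "{v, z} \<in> J" unfolding parallel_def by auto
  obtain x where x: "x \<in> {v, z} - {w}" "{x, w} \<in> J"
    using J_exchange[OF assms(1) vz(2)] vz(1) by auto
  then show False using assms neg unfolding parallel_def by (auto simp: insert_commute)
qed

lemma rep_props:
  assumes "{v} \<in> J"
  shows "{rep v} \<in> J" "parallel v (rep v)"
proof -
  have "{v} \<in> J \<and> parallel v v" using assms unfolding parallel_def by simp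
  then have "{rep v} \<in> J \<and> parallel v (rep v)"
    unfolding rep_def using assms by (simp add: LeastI[of "\<lambda>w. {w} \<in> J \<and> parallel v w" v])
  then show "{rep v} \<in> J" "parallel v (rep v)" by auto
qed

lemma rep_eq_iff:
  assumes "{v} \<in> J" "{w} \<in> J"
  shows "rep v = rep w \<longleftrightarrow> parallel v w"
proof
  assume "rep v = rep w"
  then show "parallel v w"
    using rep_props assms parallel_trans[of "rep v" v w] parallel_sym by metis
next
  assume "parallel v w"
  then have "parallel v z \<longleftrightarrow> parallel w z" for z
    using assms parallel_trans parallel_sym by metis
  then show "rep v = rep w" unfolding rep_def using assms by simp
qed

lemma points_J: "p \<in> points \<Longrightarrow> {p} \<in> J"
  unfolding points_def using rep_props by auto

lemma rep_point: "p \<in> points \<Longrightarrow> rep p = p"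
  unfolding points_def using rep_props rep_eq_iff parallel_sym by auto

lemma points_pair: "p \<in> points \<Longrightarrow> q \<in> points \<Longrightarrow> p \<noteq> q \<Longrightarrow> {p, q} \<in> J"
  using rep_eq_iff rep_point points_J unfolding parallel_def by metis

lemma points_subset: "points \<subseteq> {1..n}"
  using points_J J_subset by blast

lemma finite_point_set: "finite points"
  using points_subset finite_subset by blast

text \<open>Extend \<open>{a'}\<close> to three independent elements inside
  \<open>{a', a, b, c}\<close>. If \<open>a\<close> and \<open>a'\<close> differ they cannot occur
  together, so \<open>a\<close> is the one left out.\<close>

lemma swap_parallel:
  assumes "{a, b, c} \<in> J" "card {a, b, c} = 3" "{a'} \<in> J" "parallel a a'"
  shows "{a', b, c} \<in> J \<and> card {a', b, c} = 3"
proof -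
  obtain I where I: "I \<in> J" "{a'} \<subseteq> I" "I \<subseteq> {a'} \<union> {a, b, c}" "card I = 3"
    using augment[OF assms(3,1)] assms(2) by auto
  have fI: "finite I" using I J_finite by blast
  show ?thesis
  proof (cases "a = a'")
    case True then show ?thesis using assms by simp
  next
    case False
    then have "{a, a'} \<notin> J" using assms(4) unfolding parallel_def by simp
    then have "a \<notin> I" using J_down[OF I(1), of "{a, a'}"] I(2) by auto
    then have "I \<subseteq> {a', b, c}" using I(3) by auto
    moreover have "card {a', b, c} \<le> 3" by (simp add: card_insert_if)
    ultimately have "I = {a', b, c}" using I(4) by (metis card_seteq finite.emptyI finite_insert)
    then show ?thesis using I by simp
  qed
qed

lemma rep_triple_J:
  assumes "\<And>x. x \<in> {a, b, c} \<Longrightarrow> {x} \<in> J \<and> {f x} \<in> J \<and> parallel x (f x)"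
    and "{a, b, c} \<in> J" "card {a, b, c} = 3"
  shows "{f a, f b, f c} \<in> J \<and> card {f a, f b, f c} = 3"
proof -
  have 1: "{f a, b, c} \<in> J \<and> card {f a, b, c} = 3"
    using swap_parallel[of a b c "f a"] assms by auto
  then have "{f b, f a, c} \<in> J \<and> card {f b, f a, c} = 3"
    using swap_parallel[of b "f a" c "f b"] assms(1)[of b] by (simp add: insert_commute)
  then have "{f c, f a, f b} \<in> J \<and> card {f c, f a, f b} = 3"
    using swap_parallel[of c "f a" "f b" "f c"] assms(1)[of c] by (simp add: insert_commute)
  then show ?thesis by (simp add: insert_commute)
qed

text \<open>Independence of a triple is decided in the simplification, by replacing its elements one
  at a time with parallel ones. This lets the code store lines on representatives only.\<close>

lemma triple_J_iff:
  assumes "card T = 3"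
  shows "T \<in> J \<longleftrightarrow> T \<subseteq> {v. {v} \<in> J} \<and> inj_on rep T \<and> rep ` T \<in> J"
proof -
  obtain a b c where T: "T = {a, b, c}" "a \<noteq> b" "b \<noteq> c" "a \<noteq> c"
    using assms by (auto simp: card_3_iff)
  have fT: "finite T" using T by simp
  show ?thesis
  proof
    assume TJ: "T \<in> J"
    then have nl: "T \<subseteq> {v. {v} \<in> J}" using J_down[OF TJ] by blast
    then have "{rep a, rep b, rep c} \<in> J \<and> card {rep a, rep b, rep c} = 3"
      using rep_triple_J[of a b c rep] rep_props TJ assms unfolding T(1) by auto
    then have "rep ` T \<in> J" "card (rep ` T) = card T" using assms unfolding T(1) by auto
    then show "T \<subseteq> {v. {v} \<in> J} \<and> inj_on rep T \<and> rep ` T \<in> J"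
      using nl eq_card_imp_inj_on[OF fT] by auto
  next
    assume A: "T \<subseteq> {v. {v} \<in> J} \<and> inj_on rep T \<and> rep ` T \<in> J"
    then have inj: "inj_on rep T" and nl: "{a} \<in> J" "{b} \<in> J" "{c} \<in> J" using T(1) by auto
    \<comment> \<open>The converse replaces representatives by the original elements, so the same
      replacement lemma is used with the inverse of \<open>rep\<close> on \<open>T\<close>.\<close>
    define f where "f = inv_into T rep"
    have f: "f (rep a) = a" "f (rep b) = b" "f (rep c) = c"
      unfolding f_def using inj T(1) by (auto intro!: inv_into_f_f)
    have "card (rep ` T) = 3" using inj assms card_image by metis
    moreover have "\<And>x. x \<in> {rep a, rep b, rep c} \<Longrightarrow> {x} \<in> J \<and> {f x} \<in> J \<and> parallel x (f x)"
      using nl rep_props parallel_sym f by auto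
    ultimately show "T \<in> J"
      using rep_triple_J[of "rep a" "rep b" "rep c" f] A f T(1) by simp
  qed
qed

section \<open>Lines of the simplification\<close>

lemma span2_triple:
  assumes ab: "a \<in> points" "b \<in> points" "a \<noteq> b"
    and A: "A \<subseteq> span2 a b" "card A = 3"
  shows "A \<notin> J"
proof
  assume "A \<in> J"
  then obtain w where w: "w \<in> A - {a, b}" "insert w {a, b} \<in> J"
    using J_exchange[OF points_pair[OF ab], of A] A ab by auto
  moreover have "insert w {a, b} = {a, b, w}" by auto
  ultimately show False using A unfolding span2_def by auto
qed

lemma span2_mono:
  assumes ab: "a \<in> points" "b \<in> points" "a \<noteq> b"
    and cd: "c \<in> span2 a b" "d \<in> span2 a b" "c \<noteq> d"
  shows "span2 a b \<subseteq> span2 c d"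
proof
  fix e assume e: "e \<in> span2 a b"
  show "e \<in> span2 c d"
  proof (cases "e = c \<or> e = d")
    case False
    then have "{c, d, e} \<notin> J" using span2_triple[OF ab, of "{c, d, e}"] cd e by auto
    then show ?thesis using e unfolding span2_def by simp
  qed (use e in \<open>auto simp: span2_def\<close>)
qed

lemma span2_eq:
  assumes ab: "a \<in> points" "b \<in> points" "a \<noteq> b"
    and cd: "c \<in> span2 a b" "d \<in> span2 a b" "c \<noteq> d"
  shows "span2 c d = span2 a b"
proof
  have cdp: "c \<in> points" "d \<in> points" using cd unfolding span2_def by auto
  have "a \<in> span2 a b" "b \<in> span2 a b" using ab unfolding span2_def by auto
  then have "a \<in> span2 c d" "b \<in> span2 c d" using span2_mono[OF assms] by auto
  then show "span2 c d \<subseteq> span2 a b" using span2_mono[OF cdp cd(3)] ab by blast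
qed (rule span2_mono[OF assms])

sublocale partial_linear_space points lines
proof
  show "finite points" by (rule finite_point_set)
next
  fix l m a b assume l: "l \<in> lines" "m \<in> lines" and ab: "a \<in> l" "b \<in> l" "a \<in> m" "b \<in> m" "a \<noteq> b"
  then show "l = m" unfolding lines_def using span2_eq by blast
qed (auto simp: lines_def span2_def)

lemma collinear_iff:
  assumes "A \<subseteq> points" "card A = 3"
  shows "A \<notin> J \<longleftrightarrow> (\<exists>l \<in> lines. A \<subseteq> l)"
proof
  assume nJ: "A \<notin> J"
  obtain a b c where A: "A = {a, b, c}" "a \<noteq> b" using assms(2) by (auto simp: card_3_iff)
  then have sub: "A \<subseteq> span2 a b" using nJ assms(1) unfolding span2_def by auto
  then have "3 \<le> card (span2 a b)"
    using assms(2) finite_point_set card_mono[of "span2 a b" A] unfolding span2_def by auto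
  then have "span2 a b \<in> lines" using A assms(1) unfolding lines_def by auto
  then show "\<exists>l \<in> lines. A \<subseteq> l" using sub by blast
next
  assume "\<exists>l \<in> lines. A \<subseteq> l"
  then show "A \<notin> J" unfolding lines_def using span2_triple assms(2) by blast
qed

text \<open>All traces have exactly three points, so a triple in \<open>W\<close> is dependent iff
  it is itself a trace. The triple \<open>B0\<close> guarantees rank three on \<open>W\<close>;
  hence every independent subset of \<open>W\<close> extends to an independent triple within
  \<open>W\<close>, as the definition of \<open>six_point\<close> demands.\<close>

lemma six_point_iso:
  assumes W: "W \<subseteq> points" "card W = 6" and tr: "\<And>A. A \<in> traces W \<Longrightarrow> card A = 3"
    and B0: "B0 \<subseteq> W" "card B0 = 3" "B0 \<notin> traces W"
    and f: "bij_betw f W {1..6}"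
  shows "matroid_iso \<lparr>ground = W, indep = {I. I \<subseteq> W \<and> I \<in> J}\<rparr> (six_point ((`) f ` traces W))"
proof -
  have base: "B \<in> J \<longleftrightarrow> B \<notin> traces W" if "B \<subseteq> W" "card B = 3" for B
  proof -
    have "(\<exists>l \<in> lines. B \<subseteq> l) \<longleftrightarrow> B \<in> traces W"
    proof
      assume "\<exists>l \<in> lines. B \<subseteq> l"
      then obtain l where l: "l \<in> lines" "B \<subseteq> l" by blast
      then have "B \<subseteq> l \<inter> W" using that by simp
      moreover have fin: "finite (l \<inter> W)" using finite_line[OF l(1)] by simp
      ultimately have "l \<inter> W \<in> traces W"
        using l that card_mono[of "l \<inter> W" B] unfolding traces_def by auto
      moreover have "B = l \<inter> W"
        using tr[OF calculation] card_seteq[OF fin \<open>B \<subseteq> l \<inter> W\<close>] that(2) by simp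
      ultimately show "B \<in> traces W" by simp
    qed (auto simp: traces_def)
    then show ?thesis using collinear_iff[of B] that W by auto
  qed
  have indep: "X \<in> J \<longleftrightarrow> (\<exists>B \<subseteq> W. card B = 3 \<and> B \<notin> traces W \<and> X \<subseteq> B)" if "X \<subseteq> W" for X
  proof
    assume X: "X \<in> J"
    have B0J: "B0 \<in> J" using base B0 by simp
    obtain B where B: "B \<in> J" "X \<subseteq> B" "B \<subseteq> X \<union> B0" "card B = 3"
      using augment[OF X B0J] J_card[OF X] B0(2) by auto
    moreover have "B \<subseteq> W" using B(3) that B0(1) by blast
    ultimately show "\<exists>B \<subseteq> W. card B = 3 \<and> B \<notin> traces W \<and> X \<subseteq> B" using base by blast
  qed (use base J_down in blast)
  have inj: "inj_on f W" and fW: "f ` W = {1..6}" using f unfolding bij_betw_def by auto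
  have trW: "A \<subseteq> W" if "A \<in> traces W" for A using that unfolding traces_def by auto
  have "X \<in> J \<longleftrightarrow> f ` X \<in> indep (six_point ((`) f ` traces W))" if X: "X \<subseteq> W" for X
  proof
    assume "X \<in> J"
    then obtain B where B: "B \<subseteq> W" "card B = 3" "B \<notin> traces W" "X \<subseteq> B" using indep X by blast
    have "f ` B \<notin> (`) f ` traces W"
    proof
      assume "f ` B \<in> (`) f ` traces W"
      then obtain A where "A \<in> traces W" "f ` B = f ` A" by blast
      then show False using B(1,3) inj_on_image_eq_iff[OF inj B(1) trW[of A]] by simp
    qed
    moreover have "card (f ` B) = 3" using B inj by (metis card_image inj_on_subset)
    moreover have "f ` B \<subseteq> {1..6}" using B(1) fW by blast
    moreover have "f ` X \<subseteq> f ` B" using B(4) by (rule image_mono)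
    ultimately have "\<exists>B'. B' \<subseteq> {1..6} \<and> card B' = 3 \<and> B' \<notin> (`) f ` traces W \<and> f ` X \<subseteq> B'" by blast
    then show "f ` X \<in> indep (six_point ((`) f ` traces W))" unfolding six_point_def by simp
  next
    assume "f ` X \<in> indep (six_point ((`) f ` traces W))"
    then obtain B' where B': "B' \<subseteq> {1..6}" "card B' = 3" "B' \<notin> (`) f ` traces W" "f ` X \<subseteq> B'"
      unfolding six_point_def by auto
    then obtain B where B: "B \<subseteq> W" "B' = f ` B" using fW by (metis subset_imageE)
    have "card B = 3" using B B'(2) inj by (metis card_image inj_on_subset)
    moreover have "X \<subseteq> B"
    proof
      fix v assume "v \<in> X"
      then show "v \<in> B" using B'(4) B inj_on_image_mem_iff[OF inj, of v B] X by blast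
    qed
    ultimately show "X \<in> J" using indep[OF X] B B'(3) by blast
  qed
  then show ?thesis using f unfolding matroid_iso_def
    by (intro exI[of _ f]) (auto simp: six_point_def)
qed

end

section \<open>Recognizing the excluded minors\<close>

lemma bij_betw_Un:
  assumes "\<exists>f. bij_betw f A C" "\<exists>f. bij_betw f B D" "A \<inter> B = {}" "C \<inter> D = {}"
  shows "\<exists>f. bij_betw f (A \<union> B) (C \<union> D) \<and> f ` A = C \<and> f ` B = D"
proof -
  obtain f g where fg: "bij_betw f A C" "bij_betw g B D" using assms by blast
  define h where "h = (\<lambda>x. if x \<in> A then f x else g x)"
  have "bij_betw h A C" using fg(1) unfolding h_def by (subst bij_betw_cong[of A _ f]) auto
  moreover have "bij_betw h B D" using fg(2) assms(3) unfolding h_def by (subst bij_betw_cong[of B _ g]) auto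
  ultimately show ?thesis using bij_betw_combine[of h A C B D] assms(4) by (auto simp: bij_betw_def)
qed

lemma uniform_matroid_3_6: "uniform_matroid 3 6 = six_point {}"
proof -
  have "card I \<le> 3 \<longleftrightarrow> (\<exists>B \<subseteq> {1..6}. card B = 3 \<and> I \<subseteq> B)" if "I \<subseteq> {1..6}" for I :: "nat set"
  proof
    assume "card I \<le> 3"
    then show "\<exists>B \<subseteq> {1..6}. card B = 3 \<and> I \<subseteq> B"
      using exists_subset_between[of I 3 "{1..6}"] that by auto
  next
    assume "\<exists>B \<subseteq> {1..6}. card B = 3 \<and> I \<subseteq> B"
    then show "card I \<le> 3" by (metis card_mono finite_atLeastAtMost finite_subset)
  qed
  then show ?thesis unfolding uniform_matroid_def six_point_def
    by (auto intro!: Collect_cong)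
qed

context rank3_matroid
begin

definition has_restriction_iso :: "nat indep_system \<Rightarrow> bool" where
  "has_restriction_iso N \<longleftrightarrow> (\<exists>W \<subseteq> points. matroid_iso \<lparr>ground = W, indep = {I. I \<subseteq> W \<and> I \<in> J}\<rparr> N)"

lemma has_restriction_isoI:
  assumes W: "W \<subseteq> points" "card W = 6" and tr: "\<And>A. A \<in> traces W \<Longrightarrow> card A = 3"
    and f: "bij_betw f W {1..6}" and fL: "(`) f ` traces W = \<L>" and few: "card (traces W) \<le> 2"
  shows "has_restriction_iso (six_point \<L>)"
proof -
  have fW: "finite W" using W(2) card.infinite by fastforce
  have fT: "finite (traces W)" using fW unfolding traces_def by (auto intro: finite_subset[of _ "Pow W"])
  have "\<not> {B. B \<subseteq> W \<and> card B = 3} \<subseteq> traces W"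
  proof
    assume "{B. B \<subseteq> W \<and> card B = 3} \<subseteq> traces W"
    \<comment> \<open>Six points have 20 triples, so at most two traces cannot exhaust them.\<close>
    then have "card {B. B \<subseteq> W \<and> card B = 3} \<le> 2" using few fT card_mono le_trans by metis
    then show False using n_subsets[OF fW, of 3] W(2) by (simp add: eval_nat_numeral)
  qed
  then obtain B0 where "B0 \<subseteq> W" "card B0 = 3" "B0 \<notin> traces W" by blast
  then show ?thesis
    using six_point_iso[OF W tr _ _ _ f, of B0] W(1) fL
    unfolding has_restriction_iso_def by blast
qed

lemma finite_card_numeral: "card W = numeral k \<Longrightarrow> finite W"
  by (metis card.infinite zero_neq_numeral)

lemma has_U36:
  assumes "W \<subseteq> points" "card W = 6" "traces W = {}"
  shows "has_restriction_iso (uniform_matroid 3 6)"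
proof -
  obtain f where "bij_betw f W {1..6::nat}"
    using finite_same_card_bij[of W "{1..6::nat}"] finite_card_numeral[OF assms(2)] assms(2) by auto
  then show ?thesis unfolding uniform_matroid_3_6 using assms by (intro has_restriction_isoI[of W f]) auto
qed

lemma bij_exists:
  assumes "finite A" "finite B" "card A = card B" shows "\<exists>f. bij_betw f A B"
  using finite_same_card_bij assms by blast

lemma has_P6:
  assumes "W \<subseteq> points" "card W = 6" "card A = 3" "traces W = {A}"
  shows "has_restriction_iso P6"
proof -
  have fW: "finite W" "finite A" using finite_card_numeral assms by blast+
  have A: "A \<subseteq> W" using assms(4) unfolding traces_def by blast
  have s: "{1,2,3::nat} \<union> {4,5,6} = {1..6}" by auto
  obtain f where f: "bij_betw f (A \<union> (W - A)) ({1,2,3} \<union> {4,5,6::nat})" "f ` A = {1,2,3}"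
    using bij_betw_Un[of A "{1,2,3::nat}" "W - A" "{4,5,6}"] fW A assms
      bij_exists[of A "{1,2,3::nat}"] bij_exists[of "W - A" "{4,5,6::nat}"] by (auto simp: card_Diff_subset)
  then have "bij_betw f W {1..6}" using A s by (simp add: Un_absorb1)
  then show ?thesis unfolding P6_def using assms f(2) by (intro has_restriction_isoI[of W f]) auto
qed

lemma has_R6:
  assumes "W \<subseteq> points" "card W = 6" "card A = 3" "card B = 3" "A \<inter> B = {}" "traces W = {A, B}"
  shows "has_restriction_iso R6"
proof -
  have fW: "finite W" "finite A" "finite B" using finite_card_numeral assms by blast+
  have AB: "A \<union> B \<subseteq> W" using assms(6) unfolding traces_def by blast
  have "card (A \<union> B) = 6" using card_Un_disjoint[OF fW(2,3) assms(5)] assms(3,4) by simp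
  then have W: "A \<union> B = W" using AB fW assms by (intro card_seteq) auto
  have s: "{1,2,3::nat} \<union> {4,5,6} = {1..6}" by auto
  obtain f where f: "bij_betw f (A \<union> B) ({1,2,3} \<union> {4,5,6::nat})" "f ` A = {1,2,3}" "f ` B = {4,5,6}"
    using bij_betw_Un[of A "{1,2,3::nat}" B "{4,5,6}"] fW assms
      bij_exists[of A "{1,2,3::nat}"] bij_exists[of B "{4,5,6::nat}"] by auto
  then have "bij_betw f W {1..6}" using W s by simp
  then show ?thesis unfolding R6_def using assms f(2,3) by (intro has_restriction_isoI[of W f]) (auto simp: card_insert_if)
qed

text \<open>The bijection is assembled from four blocks: the common point goes to 1, the rests of
  \<open>A\<close> and \<open>B\<close> go to \<open>{2, 3}\<close> and \<open>{4, 5}\<close>, and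
  the remaining point goes to 6.\<close>

lemma has_Q6:
  assumes "W \<subseteq> points" "card W = 6" "card A = 3" "card B = 3" "card (A \<inter> B) = 1" "traces W = {A, B}"
  shows "has_restriction_iso Q6"
proof -
  have fW: "finite W" "finite A" "finite B" using finite_card_numeral assms by blast+
  have AB: "A \<union> B \<subseteq> W" using assms(6) unfolding traces_def by blast
  have c5: "card (A \<union> B) = 5" using card_Un_Int[of A B] fW assms by simp
  have c: "card (A - B) = 2" "card (B - A) = 2" "card (W - (A \<union> B)) = 1"
  proof -
    have "finite (A \<inter> B)" "finite (B \<inter> A)" "finite (A \<union> B)" using fW by auto
    then show "card (A - B) = 2" "card (B - A) = 2" "card (W - (A \<union> B)) = 1"
      using assms(2-5) AB c5 by (simp_all add: card_Diff_subset_Int[of A B] card_Diff_subset_Int[of B A]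
          card_Diff_subset[of "A \<union> B"] Int_commute[of B])
  qed
  obtain f1 where f1: "bij_betw f1 (A \<inter> B \<union> (A - B)) ({1} \<union> {2,3::nat})"
    "f1 ` (A \<inter> B) = {1}" "f1 ` (A - B) = {2,3}"
    using bij_betw_Un[of "A \<inter> B" "{1::nat}" "A - B" "{2,3}"] fW c assms
      bij_exists[of "A \<inter> B" "{1::nat}"] bij_exists[of "A - B" "{2,3::nat}"] by auto
  obtain f2 where f2: "bij_betw f2 ((B - A) \<union> (W - (A \<union> B))) ({4,5} \<union> {6::nat})"
    "f2 ` (B - A) = {4,5}" "f2 ` (W - (A \<union> B)) = {6}"
    using bij_betw_Un[of "B - A" "{4,5::nat}" "W - (A \<union> B)" "{6}"] fW c assms
      bij_exists[of "B - A" "{4,5::nat}"] bij_exists[of "W - (A \<union> B)" "{6::nat}"] by auto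
  define f where "f x = (if x \<in> A then f1 x else f2 x)" for x
  have "bij_betw f A {1,2,3}"
    using f1(1) unfolding f_def by (subst bij_betw_cong[of A _ f1]) (auto simp: Int_Diff_Un insert_commute)
  moreover have "bij_betw f (W - A) {4,5,6}"
  proof -
    have "(B - A) \<union> (W - (A \<union> B)) = W - A" using AB by auto
    then show ?thesis using f2(1) unfolding f_def by (subst bij_betw_cong[of "W - A" _ f2]) (auto simp: insert_commute)
  qed
  ultimately have "bij_betw f (A \<union> (W - A)) ({1,2,3} \<union> {4,5,6})" by (rule bij_betw_combine) auto
  moreover have "A \<union> (W - A) = W" "{1,2,3::nat} \<union> {4,5,6} = {1..6}" using AB by auto
  ultimately have bij: "bij_betw f W {1..6}" by simp
  have fA: "f ` A = {1,2,3}" using \<open>bij_betw f A {1,2,3}\<close> by (simp add: bij_betw_def)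
  have "f ` B = f ` (A \<inter> B) \<union> f ` (B - A)" by blast
  also have "\<dots> = f1 ` (A \<inter> B) \<union> f2 ` (B - A)" unfolding f_def by (intro arg_cong2[where f="(\<union>)"] image_cong) auto
  also have "\<dots> = {1,4,5}" using f1(2) f2(2) by auto
  finally have fB: "f ` B = {1,4,5}" .
  show ?thesis unfolding Q6_def
    using assms bij fA fB by (intro has_restriction_isoI[of W f]) (auto simp: card_insert_if)
qed

lemma rich_points_restriction:
  assumes xy: "x \<in> points" "y \<in> points" "x \<noteq> y" "200 \<le> card (pencil x)" "200 \<le> card (pencil y)"
    and N: "N = uniform_matroid 3 6 \<or> N = P6 \<or> N = Q6 \<or> N = R6"
  shows "has_restriction_iso N"
  using N
proof (elim disjE)
  assume "N = uniform_matroid 3 6"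
  then show ?thesis using generic_six[OF xy] has_U36 by blast
next
  assume "N = P6"
  then show ?thesis using six_with_one_line[OF xy(1,4)] has_P6 by blast
next
  assume "N = Q6"
  obtain W A B where "W \<subseteq> points" "card W = 6" "card A = 3" "card B = 3" "card (A \<inter> B) = 1" "traces W = {A, B}"
    using six_with_two_meeting_lines[OF xy(1,4)] by (elim exE conjE)
  then show ?thesis unfolding \<open>N = Q6\<close> by (rule has_Q6)
next
  assume "N = R6"
  obtain W A B where "W \<subseteq> points" "card W = 6" "card A = 3" "card B = 3" "A \<inter> B = {}" "traces W = {A, B}"
    using six_with_two_disjoint_lines[OF xy(3-5)] by (elim exE conjE)
  then show ?thesis unfolding \<open>N = R6\<close> by (rule has_R6)
qed

text \<open>Contracting \<open>x\<close> turns each line through \<open>x\<close> into a parallel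
  class. One further point on each of \<open>k\<close> such lines gives \<open>k\<close> pairwise
  nonparallel elements of a rank-2 matroid; one rich point is enough here.\<close>

lemma rich_point_U2:
  assumes x: "x \<in> points" "k \<le> card (pencil x)" and k: "2 \<le> k"
  obtains Y where "Y \<subseteq> points - {x}"
    "matroid_iso \<lparr>ground = Y, indep = {I. I \<subseteq> Y \<and> insert x I \<in> J}\<rparr> (uniform_matroid 2 k)"
proof -
  obtain Q where Q: "Q \<subseteq> pencil x" "card Q = k" using ex_subset_card[OF x(2)] by blast
  have fQ: "finite Q" using Q(1) finite_pencil finite_subset by blast
  have "\<exists>y \<in> l. y \<noteq> x" if "l \<in> pencil x" for l
    using other_point[of l x x] that unfolding pencil_def by auto
  then obtain q where q: "\<And>l. l \<in> pencil x \<Longrightarrow> q l \<in> l \<and> q l \<noteq> x" by metis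
  define Y where "Y = q ` Q"
  have inj: "inj_on q Q" using q pencil_disjoint Q(1) by (intro inj_onI) (metis subsetD)
  have cY: "card Y = k" "finite Y" unfolding Y_def using inj Q fQ by (auto simp: card_image)
  have Yp: "Y \<subseteq> points" "x \<notin> Y" using q Q(1) line_subset unfolding Y_def pencil_def by blast+
  have pair: "insert x {y, z} \<in> J" if yz: "y \<in> Y" "z \<in> Y" "y \<noteq> z" for y z
  proof (rule ccontr)
    assume nJ: "insert x {y, z} \<notin> J"
    obtain l m where lm: "l \<in> Q" "m \<in> Q" "y = q l" "z = q m" using yz unfolding Y_def by auto
    have "{x, y, z} \<subseteq> points" "card {x, y, z} = 3" using yz Yp x by (auto simp: card_insert_if)
    then obtain t where t: "t \<in> lines" "{x, y, z} \<subseteq> t" using nJ collinear_iff[of "{x, y, z}"] by auto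
    then have tp: "t \<in> pencil x" unfolding pencil_def by simp
    have "t = l" using pencil_disjoint[OF tp, of l y] q[of l] lm t Q(1) by auto
    moreover have "t = m" using pencil_disjoint[OF tp, of m z] q[of m] lm t Q(1) by auto
    ultimately show False using lm that by simp
  qed
  have ind: "insert x I \<in> J \<longleftrightarrow> card I \<le> 2" if I: "I \<subseteq> Y" for I
  proof
    assume "insert x I \<in> J"
    then have "card (insert x I) \<le> 3" by (rule J_card)
    moreover have "x \<notin> I" "finite I" using that Yp cY finite_subset by blast+
    ultimately show "card I \<le> 2" by simp
  next
    assume "card I \<le> 2"
    then obtain Z where Z: "I \<subseteq> Z" "Z \<subseteq> Y" "card Z = 2"
      using exists_subset_between[of I 2 Y] I cY k by auto
    then obtain y z where "Z = {y, z}" "y \<noteq> z" by (auto simp: card_2_iff)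
    then have "insert x Z \<in> J" using pair Z by auto
    then show "insert x I \<in> J" using J_down Z(1) by blast
  qed
  obtain f where f: "bij_betw f Y {1..k}"
    using finite_same_card_bij[of Y "{1..k}"] cY by auto
  have "matroid_iso \<lparr>ground = Y, indep = {I. I \<subseteq> Y \<and> insert x I \<in> J}\<rparr> (uniform_matroid 2 k)"
    unfolding matroid_iso_def
  proof (intro exI[of _ f] conjI allI impI)
    show "bij_betw f (ground \<lparr>ground = Y, indep = {I. I \<subseteq> Y \<and> insert x I \<in> J}\<rparr>) (ground (uniform_matroid 2 k))"
      using f unfolding uniform_matroid_def by simp
    fix X assume "X \<subseteq> ground \<lparr>ground = Y, indep = {I. I \<subseteq> Y \<and> insert x I \<in> J}\<rparr>"
    then have X: "X \<subseteq> Y" by simp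
    have "card (f ` X) = card X" using X f by (meson bij_betw_def card_image inj_on_subset)
    moreover have "f ` X \<subseteq> {1..k}" using X f unfolding bij_betw_def by blast
    ultimately show "X \<in> indep \<lparr>ground = Y, indep = {I. I \<subseteq> Y \<and> insert x I \<in> J}\<rparr> \<longleftrightarrow>
        f ` X \<in> indep (uniform_matroid 2 k)"
      using ind[OF X] X unfolding uniform_matroid_def by simp
  qed
  then show thesis using that[of Y] Yp by blast
qed

end

section \<open>Encoding matroids of rank at most three\<close>

text \<open>A code consists of a map \<open>\<phi>\<close> sending each element to the representative of its parallel class
  (loops are sent to 0) and of a map \<open>\<mu>\<close> sending each representative to the labels of the
  nontrivial lines through it.\<close>

definition decode :: "nat \<Rightarrow> (nat \<Rightarrow> nat) \<Rightarrow> (nat \<Rightarrow> nat set) \<Rightarrow> nat set set" where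
  "decode n \<phi> \<mu> = {T. T \<subseteq> {1..n} \<and> card T = 3 \<and> 0 \<notin> \<phi> ` T \<and> inj_on \<phi> T \<and> (\<Inter>t \<in> T. \<mu> (\<phi> t)) = {}}"

text \<open>At most \<open>K\<close> of the \<open>n * K\<close> line labels are stored per
  representative. The pair \<open>x\<close>, \<open>\<rho>\<close> overrides this for a single
  exceptional point, whose label set may have any size.\<close>

definition triple_systems :: "nat \<Rightarrow> nat \<Rightarrow> nat set set set" where
  "triple_systems n K = (\<lambda>(\<phi>, \<mu>, x, \<rho>). decode n \<phi> (\<mu>(x := \<rho>))) `
     (({1..n} \<rightarrow>\<^sub>E {0..n}) \<times> ({1..n} \<rightarrow>\<^sub>E {A. A \<subseteq> {..<n * K} \<and> card A \<le> K}) \<times> {0..n} \<times> Pow {..<n * K})"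

text \<open>A set of size at most \<open>K + 1\<close> is a set of size at most \<open>K\<close>
  with possibly one more element, which leaves \<open>card X + 1\<close> choices per step.\<close>

lemma card_small_subsets:
  "finite X \<Longrightarrow> card {A. A \<subseteq> X \<and> card A \<le> K} \<le> (card X + 1) ^ K"
proof (induction K)
  case 0
  have "{A. A \<subseteq> X \<and> card A \<le> 0} = {{}}" using 0 finite_subset by fastforce
  then show ?case by simp
next
  case (Suc K)
  let ?F = "\<lambda>K. {A. A \<subseteq> X \<and> card A \<le> K}"
  have "?F (Suc K) \<subseteq> (\<lambda>(o', A). case o' of None \<Rightarrow> A | Some a \<Rightarrow> insert a A) ` (insert None (Some ` X) \<times> ?F K)"
  proof
    fix A assume A: "A \<in> ?F (Suc K)"
    show "A \<in> (\<lambda>(o', A). case o' of None \<Rightarrow> A | Some a \<Rightarrow> insert a A) ` (insert None (Some ` X) \<times> ?F K)"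
    proof (cases "A = {}")
      case True
      then show ?thesis by (intro image_eqI[of _ _ "(None, {})"]) auto
    next
      case False
      then obtain a where a: "a \<in> A" by blast
      have "finite A" using A Suc.prems finite_subset by blast
      then have "card (A - {a}) \<le> K" using A a by (auto simp: card_Diff_singleton)
      then show ?thesis using A a by (intro image_eqI[of _ _ "(Some a, A - {a})"]) auto
    qed
  qed
  moreover have fF: "finite (?F K)" using Suc.prems by simp
  ultimately have "card (?F (Suc K)) \<le> card (insert None (Some ` X) \<times> ?F K)"
    using Suc.prems by (meson finite_SigmaI finite_imageI finite_insert surj_card_le)
  also have "\<dots> = (card X + 1) * card (?F K)"
    using Suc.prems by (subst card_cartesian_product, subst card_insert_disjoint) (auto simp: card_image)
  also have "\<dots> \<le> (card X + 1) ^ Suc K" unfolding power_Suc by (rule mult_le_mono2[OF Suc.IH[OF Suc.prems]])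
  finally show ?case .
qed

lemma triple_systems_bound:
  shows finite_triple_systems: "finite (triple_systems n K)"
    and card_triple_systems: "card (triple_systems n K) \<le> (n + 1) ^ n * ((n * K + 1) ^ K) ^ n * (n + 1) * 2 ^ (n * K)"
proof -
  let ?F = "{A. A \<subseteq> {..<n * K} \<and> card A \<le> K}"
  let ?C = "({1..n} \<rightarrow>\<^sub>E {0..n}) \<times> ({1..n} \<rightarrow>\<^sub>E ?F) \<times> {0..n} \<times> Pow {..<n * K}"
  have fC: "finite ?C" by (intro finite_cartesian_product finite_PiE) auto
  then show "finite (triple_systems n K)" unfolding triple_systems_def by simp
  have "card (triple_systems n K) \<le> card ?C" unfolding triple_systems_def by (rule card_image_le[OF fC])
  also have "\<dots> = (n + 1) ^ n * (card ?F ^ n * ((n + 1) * 2 ^ (n * K)))"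
    by (simp add: card_cartesian_product card_PiE card_Pow)
  also have "\<dots> \<le> (n + 1) ^ n * (((n * K + 1) ^ K) ^ n * ((n + 1) * 2 ^ (n * K)))"
    using card_small_subsets[of "{..<n * K}" K] by (intro mult_le_mono power_mono) auto
  finally show "card (triple_systems n K) \<le> (n + 1) ^ n * ((n * K + 1) ^ K) ^ n * (n + 1) * 2 ^ (n * K)"
    by (simp only: mult.assoc)
qed

context rank3_matroid
begin

text \<open>Label the lines injectively. Three distinct representatives are dependent iff they lie
  on a common line, that is, iff their label sets share a label; this is the test made by
  \<open>decode\<close>.\<close>

lemma bases_in_triple_systems:
  assumes few: "\<And>x y. \<lbrakk>x \<in> points; y \<in> points; x \<noteq> y; K \<le> card (pencil x)\<rbrakk> \<Longrightarrow> card (pencil y) < K"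
  shows "{T \<in> J. card T = 3} \<in> triple_systems n K"
proof -
  \<comment> \<open>If no point is rich, the exceptional point is the dummy 0, which represents no
    element.\<close>
  obtain x where x: "x \<in> {0..n}" "\<And>p. p \<in> points - {x} \<Longrightarrow> card (pencil p) \<le> K"
  proof (cases "\<exists>x \<in> points. K \<le> card (pencil x)")
    case True
    then obtain x where "x \<in> points" "K \<le> card (pencil x)" by blast
    moreover have "x \<in> {0..n}" using points_subset calculation by auto
    ultimately show ?thesis using few that[of x] by fastforce
  next
    case False
    then show ?thesis using that[of 0] by fastforce
  qed
  \<comment> \<open>Every line has a point other than \<open>x\<close>, and each such point lies on
    at most \<open>K\<close> lines. So \<open>n * K\<close> labels suffice, although
    \<open>x\<close> itself may lie on many lines.\<close>
  have "lines \<subseteq> (\<Union>p \<in> points - {x}. pencil p)"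
  proof
    fix l assume l: "l \<in> lines"
    then obtain p where "p \<in> l" "p \<noteq> x" using other_point[of l x x] by auto
    then show "l \<in> (\<Union>p \<in> points - {x}. pencil p)" using l line_subset unfolding pencil_def by blast
  qed
  then have "card lines \<le> card (\<Union>p \<in> points - {x}. pencil p)"
    using finite_point_set finite_pencil by (intro card_mono) auto
  also have "\<dots> \<le> (\<Sum>p \<in> points - {x}. card (pencil p))" using finite_point_set by (intro card_UN_le) auto
  also have "\<dots> \<le> card (points - {x}) * K" using sum_bounded_above[of "points - {x}" _ K] x(2) by simp
  also have "card (points - {x}) \<le> card {1..n}" using points_subset by (intro card_mono) auto
  finally have "card lines \<le> card {..<n * K}" by simp
  then obtain g where g: "inj_on g lines" "g ` lines \<subseteq> {..<n * K}"
    using finite_lines by (metis finite_lessThan inj_on_iff_card_le)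
  define \<phi> where "\<phi> = restrict rep {1..n}"
  define \<mu> where "\<mu> = (\<lambda>p \<in> {1..n}. if p \<in> points - {x} then g ` pencil p else {})"
  define \<rho> where "\<rho> = g ` pencil x"
  have pl: "pencil p \<subseteq> lines" for p unfolding pencil_def by auto
  have lab: "(\<mu>(x := \<rho>)) p = g ` pencil p" if "p \<in> points" for p
    using that points_subset unfolding \<mu>_def \<rho>_def by auto
  have repn: "rep v \<le> n" "{v} \<in> J \<Longrightarrow> rep v \<in> points" for v
  proof -
    show p: "rep v \<in> points" if "{v} \<in> J" for v using that unfolding points_def by simp
    show "rep v \<le> n"
    proof (cases "{v} \<in> J")
      case True then show ?thesis using p[OF True] points_subset by auto
    qed (simp add: rep_def)
  qed
  have "T \<in> J \<longleftrightarrow> T \<subseteq> {1..n} \<and> 0 \<notin> \<phi> ` T \<and> inj_on \<phi> T \<and> (\<Inter>t \<in> T. (\<mu>(x := \<rho>)) (\<phi> t)) = {}"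
    if cT: "card T = 3" for T
  proof (cases "T \<subseteq> {v. {v} \<in> J} \<and> inj_on rep T")
    case True
    then have T: "T \<subseteq> {1..n}" using J_subset by blast
    have ph: "\<phi> t = rep t" if "t \<in> T" for t using that T unfolding \<phi>_def by auto
    have reps: "rep ` T \<subseteq> points" "card (rep ` T) = 3" using True repn(2) cT by (auto simp: card_image)
    have ne: "T \<noteq> {}" using cT by auto
    have "0 \<notin> \<phi> ` T" using reps(1) points_subset ph by fastforce
    moreover have "inj_on \<phi> T" using True ph inj_on_cong[of T \<phi> rep] by auto
    moreover have "(\<mu>(x := \<rho>)) (\<phi> t) = g ` pencil (rep t)" if "t \<in> T" for t
      using lab[of "rep t"] reps(1) that unfolding ph[OF that] by blast
    then have "(\<Inter>t \<in> T. (\<mu>(x := \<rho>)) (\<phi> t)) = (\<Inter>t \<in> T. g ` pencil (rep t))"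
      by (intro INF_cong) simp_all
    \<comment> \<open>Injectivity of the labelling turns a common label into a common line.\<close>
    moreover have "(\<Inter>t \<in> T. g ` pencil (rep t)) = g ` (\<Inter>t \<in> T. pencil (rep t))"
      using image_INT[OF g(1), of T "\<lambda>t. pencil (rep t)"] pl ne by auto
    moreover have "(\<Inter>t \<in> T. pencil (rep t)) = {l \<in> lines. rep ` T \<subseteq> l}"
      using ne unfolding pencil_def by auto
    ultimately show ?thesis
      using T True triple_J_iff[OF cT] collinear_iff[OF reps] by auto
  next
    case False
    have "\<not> (T \<subseteq> {1..n} \<and> 0 \<notin> \<phi> ` T \<and> inj_on \<phi> T)"
    proof
      assume A: "T \<subseteq> {1..n} \<and> 0 \<notin> \<phi> ` T \<and> inj_on \<phi> T"
      then have ph: "\<phi> t = rep t" if "t \<in> T" for t using that unfolding \<phi>_def by auto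
      then have "inj_on rep T" using A inj_on_cong[of T \<phi> rep] by auto
      moreover have "T \<subseteq> {v. {v} \<in> J}" using A ph unfolding rep_def by fastforce
      ultimately show False using False by simp
    qed
    then show ?thesis using False triple_J_iff[OF cT] by blast
  qed
  then have key: "T \<in> J \<and> card T = 3 \<longleftrightarrow> T \<subseteq> {1..n} \<and> card T = 3 \<and> 0 \<notin> \<phi> ` T \<and> inj_on \<phi> T \<and>
      (\<Inter>t \<in> T. (\<mu>(x := \<rho>)) (\<phi> t)) = {}" for T
    by blast
  have "{T \<in> J. card T = 3} = decode n \<phi> (\<mu>(x := \<rho>))"
    unfolding decode_def by (rule Collect_cong) (rule key)
  moreover have "\<phi> \<in> {1..n} \<rightarrow>\<^sub>E {0..n}" unfolding \<phi>_def using repn(1) by auto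
  moreover have "\<mu> \<in> {1..n} \<rightarrow>\<^sub>E {A. A \<subseteq> {..<n * K} \<and> card A \<le> K}"
  proof -
    have "g ` pencil p \<subseteq> {..<n * K}" "card (g ` pencil p) = card (pencil p)" for p
      using g pl[of p] card_image inj_on_subset by blast+
    then show ?thesis using x(2) unfolding \<mu>_def by auto
  qed
  moreover have "\<rho> \<in> Pow {..<n * K}" unfolding \<rho>_def using g pl by blast
  ultimately show ?thesis unfolding triple_systems_def using x(1)
    by (intro image_eqI[of _ _ "(\<phi>, \<mu>, x, \<rho>)"]) auto
qed

end

section \<open>Contractions to rank three\<close>

lemma matroid_rank_indep:
  assumes "is_matroid M" "C \<in> indep M"
  shows "matroid_rank M C = card C"
proof -
  have fin: "finite C" using assms unfolding is_matroid_def by (meson PowD finite_subset subsetD)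
  show ?thesis unfolding matroid_rank_def
  proof (rule Max_eqI)
    show "finite (card ` {I \<in> indep M. I \<subseteq> C})" using fin by simp
    show "y \<le> card C" if "y \<in> card ` {I \<in> indep M. I \<subseteq> C}" for y
      using that fin card_mono by auto
    show "card C \<in> card ` {I \<in> indep M. I \<subseteq> C}" using assms by auto
  qed
qed

lemma matroid_rank_eq_card_iff:
  assumes "is_matroid M" "X \<subseteq> ground M"
  shows "matroid_rank M X = card X \<longleftrightarrow> X \<in> indep M"
proof
  assume eq: "matroid_rank M X = card X"
  have "finite (ground M)" using assms(1) unfolding is_matroid_def by (rule conjunct1)
  then have fin: "finite X" using assms(2) by (rule rev_finite_subset)
  have "Max (card ` {I \<in> indep M. I \<subseteq> X}) \<in> card ` {I \<in> indep M. I \<subseteq> X}"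
  proof (rule Max_in)
    show "finite (card ` {I \<in> indep M. I \<subseteq> X})" using fin by simp
    show "card ` {I \<in> indep M. I \<subseteq> X} \<noteq> {}" using assms(1) unfolding is_matroid_def by auto
  qed
  then obtain I where "I \<in> indep M" "I \<subseteq> X" "card I = card X" using eq unfolding matroid_rank_def by auto
  then show "X \<in> indep M" using card_subset_eq[OF fin] by metis
qed (rule matroid_rank_indep[OF assms(1)])

text \<open>For independent \<open>C\<close> the rank of \<open>C\<close> is \<open>card C\<close>,
  so the rank condition in \<open>contract\<close> becomes independence of
  \<open>I \<union> C\<close>.\<close>

lemma is_minor_contract_restrict:
  assumes M: "is_matroid M" and C: "C \<in> indep M" and W: "W \<subseteq> ground M - C"
  shows "is_minor \<lparr>ground = W, indep = {I. I \<subseteq> W \<and> I \<union> C \<in> indep M}\<rparr> M"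
proof -
  have CG: "C \<subseteq> ground M" using M C unfolding is_matroid_def by blast
  have fin: "finite (ground M)" using M unfolding is_matroid_def by simp
  have iff: "matroid_rank M (I \<union> C) = card I + matroid_rank M C \<longleftrightarrow> I \<union> C \<in> indep M"
    if "I \<subseteq> ground M - C" for I
  proof -
    have "finite I" "finite C" using that CG fin finite_subset by blast+
    then have "card (I \<union> C) = card I + card C" using that by (intro card_Un_disjoint) auto
    then show ?thesis
      using matroid_rank_eq_card_iff[OF M, of "I \<union> C"] matroid_rank_indep[OF M C] that CG by auto
  qed
  have "\<lparr>ground = W, indep = {I. I \<subseteq> W \<and> I \<union> C \<in> indep M}\<rparr> = delete (contract M C) (ground M - C - W)"
    unfolding delete_def contract_def using W iff by auto
  then show ?thesis unfolding is_minor_def using CG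
    by (intro exI[of _ C] exI[of _ "ground M - C - W"]) auto
qed

definition excluded :: "nat indep_system \<Rightarrow> bool" where
  "excluded N \<longleftrightarrow> (\<exists>k \<ge> 2. N = uniform_matroid 2 k) \<or> N = uniform_matroid 3 6 \<or>
           N = P6 \<or> N = Q6 \<or> N = R6"

text \<open>For independent \<open>S\<close> and a matroid of rank \<open>card S + 3\<close> these
  are the bases of \<open>M / S\<close>; for dependent \<open>S\<close> the family is empty.\<close>

definition link :: "nat \<Rightarrow> nat indep_system \<Rightarrow> nat set \<Rightarrow> nat set set" where
  "link n M S = {T. T \<subseteq> {1..n} - S \<and> card T = 3 \<and> T \<union> S \<in> indep M}"

text \<open>The constant depends on \<open>N\<close> alone: it is \<open>k\<close> for
  \<open>U_{2,k}\<close>, where one rich point already yields the minor, and otherwise the threshold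
  200, where two rich points do.\<close>

lemma link_in_triple_systems:
  assumes N: "excluded N"
  shows "\<exists>K. \<forall>n M S. M \<in> matroids_on n \<longrightarrow> \<not> has_minor_iso M N \<longrightarrow>
    (\<forall>I \<in> indep M. card I \<le> card S + 3) \<longrightarrow> S \<in> indep M \<longrightarrow> link n M S \<in> triple_systems n K"
proof -
  define K where "K = (if \<exists>k \<ge> 2. N = uniform_matroid 2 k then SOME k. 2 \<le> k \<and> N = uniform_matroid 2 k else 200)"
  have "link n M S \<in> triple_systems n K"
    if M: "M \<in> matroids_on n" and no: "\<not> has_minor_iso M N"
      and rk: "\<forall>I \<in> indep M. card I \<le> card S + 3" and S: "S \<in> indep M" for n M S
  proof -
    have mat: "is_matroid M" "ground M = {1..n}" using M unfolding matroids_on_def by auto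
    define J where "J = {I. I \<subseteq> {1..n} - S \<and> I \<union> S \<in> indep M}"
    have SG: "S \<subseteq> {1..n}" using mat S unfolding is_matroid_def by blast
    have cardU: "card (I \<union> S) = card I + card S" if "I \<subseteq> {1..n} - S" for I
      using that SG finite_subset[of _ "{1..n}"] by (intro card_Un_disjoint) auto
    \<comment> \<open>The elements of \<open>S\<close> become loops of \<open>J\<close>, so all
      contractions share the ground set \<open>{1..n}\<close> and the same codes.\<close>
    interpret rank3_matroid n J
    proof
      show "{} \<in> J" using S unfolding J_def by simp
      show "I' \<in> J" if "I \<in> J" "I' \<subseteq> I" for I I'
      proof -
        have "I' \<union> S \<subseteq> I \<union> S" "I \<union> S \<in> indep M" using that unfolding J_def by auto
        then have "I' \<union> S \<in> indep M" using mat(1) unfolding is_matroid_def by blast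
        then show ?thesis using that unfolding J_def by blast
      qed
      show "\<exists>x \<in> I' - I. insert x I \<in> J" if "I \<in> J" "I' \<in> J" "card I < card I'" for I I'
      proof -
        have "I \<union> S \<in> indep M" "I' \<union> S \<in> indep M" "card (I \<union> S) < card (I' \<union> S)"
          using that cardU unfolding J_def by auto
        then obtain x where "x \<in> (I' \<union> S) - (I \<union> S)" "insert x (I \<union> S) \<in> indep M"
          using mat(1) unfolding is_matroid_def by blast
        then show ?thesis using that unfolding J_def by (intro bexI[of _ x]) auto
      qed
      show "card I \<le> 3" if "I \<in> J" for I using that cardU rk unfolding J_def by fastforce
    qed (auto simp: J_def)
    \<comment> \<open>Minors of \<open>M / S\<close> are minors of \<open>M\<close>. This is applied
      with \<open>C = {x}\<close> for \<open>U_{2,k}\<close> and with \<open>C = {}\<close> for the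
      six-element matroids.\<close>
    have minor: "has_minor_iso M N'"
      if C: "C \<in> J" and W: "W \<subseteq> points - C"
        and iso: "matroid_iso \<lparr>ground = W, indep = {I. I \<subseteq> W \<and> I \<union> C \<in> J}\<rparr> N'" for C W N'
    proof -
      have WS: "W \<subseteq> {1..n} - S" using W points_J unfolding J_def by blast
      have CS: "C \<subseteq> {1..n} - S" "C \<union> S \<in> indep M" using C unfolding J_def by auto
      have eq: "{I. I \<subseteq> W \<and> I \<union> C \<in> J} = {I. I \<subseteq> W \<and> I \<union> (C \<union> S) \<in> indep M}"
        using WS CS(1) unfolding J_def by (auto simp: Un_assoc)
      have "W \<subseteq> ground M - (C \<union> S)" using W WS mat(2) by blast
      then have "is_minor \<lparr>ground = W, indep = {I. I \<subseteq> W \<and> I \<union> (C \<union> S) \<in> indep M}\<rparr> M"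
        by (rule is_minor_contract_restrict[OF mat(1) CS(2)])
      then show ?thesis using iso unfolding eq has_minor_iso_def by blast
    qed
    have "card (pencil y) < K" if xy: "x \<in> points" "y \<in> points" "x \<noteq> y" "K \<le> card (pencil x)" for x y
    proof (rule ccontr)
      assume "\<not> card (pencil y) < K"
      then have y: "K \<le> card (pencil y)" by simp
      show False
      proof (cases "\<exists>k \<ge> 2. N = uniform_matroid 2 k")
        case True
        then have K: "2 \<le> K \<and> N = uniform_matroid 2 K"
          unfolding K_def using someI_ex[of "\<lambda>k. 2 \<le> k \<and> N = uniform_matroid 2 k"] by auto
        obtain Y where Y: "Y \<subseteq> points - {x}"
          "matroid_iso \<lparr>ground = Y, indep = {I. I \<subseteq> Y \<and> insert x I \<in> J}\<rparr> (uniform_matroid 2 K)"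
          using rich_point_U2[OF xy(1,4)] K by blast
        then show False using minor[OF points_J[OF xy(1)] Y(1), of N] K no by simp
      next
        case False
        then have "K = 200" "N = uniform_matroid 3 6 \<or> N = P6 \<or> N = Q6 \<or> N = R6"
          using N unfolding K_def excluded_def by auto
        then have "has_restriction_iso N" using rich_points_restriction[OF xy(1-3)] xy(4) y by simp
        then obtain W where W: "W \<subseteq> points" "matroid_iso \<lparr>ground = W, indep = {I. I \<subseteq> W \<and> I \<in> J}\<rparr> N"
          unfolding has_restriction_iso_def by blast
        then show False using minor[OF J_empty, of W N] no by simp
      qed
    qed
    then have "{T \<in> J. card T = 3} \<in> triple_systems n K" by (rule bases_in_triple_systems)
    moreover have "{T \<in> J. card T = 3} = link n M S" unfolding link_def J_def by auto
    ultimately show ?thesis by simp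
  qed
  then show ?thesis by blast
qed

section \<open>Covering the \<open>r\<close>-sets by \<open>(r - 3)\<close>-sets\<close>

text \<open>Double counting of the related pairs: the average number of \<open>y\<close> related to
  one \<open>x\<close> is at least \<open>card Y * d / card X\<close>.\<close>

lemma exists_popular:
  assumes "finite Y" "finite X" "X \<noteq> {}"
    and deg: "\<And>y. y \<in> Y \<Longrightarrow> d \<le> card {x \<in> X. R x y}"
  shows "\<exists>x \<in> X. real (card Y) * (real d / real (card X)) \<le> real (card {y \<in> Y. R x y})"
proof (rule ccontr)
  assume neg: "\<not> ?thesis"
  have pos: "0 < card X" using assms by (simp add: card_gt_0_iff)
  have "real (card Y) * real d \<le> (\<Sum>y\<in>Y. real (card {x \<in> X. R x y}))"
    using deg sum_mono[of Y "\<lambda>_. real d" "\<lambda>y. real (card {x \<in> X. R x y})"] by simp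
  also have "\<dots> = (\<Sum>x\<in>X. real (card {y \<in> Y. R x y}))"
  proof -
    have "(\<Sum>y\<in>Y. card {x \<in> X. R x y}) = (\<Sum>y\<in>Y. \<Sum>x\<in>X. if R x y then 1 else 0)"
      using assms(2) by (simp add: sum.If_cases Int_def)
    also have "\<dots> = (\<Sum>x\<in>X. \<Sum>y\<in>Y. if R x y then 1 else 0)" by (rule sum.swap)
    also have "\<dots> = (\<Sum>x\<in>X. card {y \<in> Y. R x y})"
      using assms(1) by (simp add: sum.If_cases Int_def)
    finally show ?thesis by (simp flip: of_nat_sum)
  qed
  also have "\<dots> < (\<Sum>x\<in>X. real (card Y) * (real d / real (card X)))"
    using neg assms by (intro sum_strict_mono) auto
  also have "\<dots> = real (card Y) * real d" using pos by simp
  finally show False by simp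
qed

text \<open>Each round takes the most useful element and multiplies the uncovered part by at most
  \<open>1 - d / card X\<close>.\<close>

lemma greedy_cover:
  assumes fin: "finite Y" "finite X" "X \<noteq> {}"
    and deg: "\<And>y. y \<in> Y \<Longrightarrow> d \<le> card {x \<in> X. R x y}" and d: "0 < d" "d \<le> card X"
  shows "\<exists>Z \<subseteq> X. (\<forall>y \<in> Y. \<exists>x \<in> Z. R x y) \<and>
    real (card Z) \<le> real t + real (card Y) * (1 - real d / real (card X)) ^ t"
proof -
  define \<delta> where "\<delta> = real d / real (card X)"
  have pos: "0 < card X" using fin by (simp add: card_gt_0_iff)
  then have \<delta>: "0 \<le> 1 - \<delta>" unfolding \<delta>_def using d by simp
  have "\<exists>Z \<subseteq> X. card Z \<le> t \<and> real (card {y \<in> Y. \<forall>x \<in> Z. \<not> R x y}) \<le> real (card Y) * (1 - \<delta>) ^ t"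
  proof (induction t)
    case 0 then show ?case by (intro exI[of _ "{}"]) auto
  next
    case (Suc t)
    then obtain Z where Z: "Z \<subseteq> X" "card Z \<le> t"
      "real (card {y \<in> Y. \<forall>x \<in> Z. \<not> R x y}) \<le> real (card Y) * (1 - \<delta>) ^ t" by blast
    define U where "U = {y \<in> Y. \<forall>x \<in> Z. \<not> R x y}"
    have fU: "finite U" unfolding U_def using fin by simp
    have "d \<le> card {x \<in> X. R x y}" if "y \<in> U" for y using that deg unfolding U_def by auto
    then obtain a where a: "a \<in> X" "real (card U) * \<delta> \<le> real (card {y \<in> U. R a y})"
      using exists_popular[OF fU fin(2,3), of d R] unfolding \<delta>_def by blast
    have "{y \<in> Y. \<forall>x \<in> insert a Z. \<not> R x y} = U - {y \<in> U. R a y}" unfolding U_def by auto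
    then have "real (card {y \<in> Y. \<forall>x \<in> insert a Z. \<not> R x y}) = real (card U) - real (card {y \<in> U. R a y})"
      using fU by (simp add: card_Diff_subset card_mono of_nat_diff)
    also have "\<dots> \<le> real (card U) * (1 - \<delta>)" using a(2) by (simp add: algebra_simps)
    also have "\<dots> \<le> (real (card Y) * (1 - \<delta>) ^ t) * (1 - \<delta>)"
      using Z(3) \<delta> unfolding U_def by (intro mult_right_mono) auto
    finally have "real (card {y \<in> Y. \<forall>x \<in> insert a Z. \<not> R x y}) \<le> real (card Y) * (1 - \<delta>) ^ Suc t"
      by (simp add: mult_ac)
    moreover have "card (insert a Z) \<le> Suc t" using Z(2) card_insert_le_m1[of "Suc t" Z a] by (simp add: card_insert_if finite_subset[OF Z(1) fin(2)])
    ultimately show ?case using Z(1) a(1) by (intro exI[of _ "insert a Z"]) blast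
  qed
  then obtain Z where Z: "Z \<subseteq> X" "card Z \<le> t"
    "real (card {y \<in> Y. \<forall>x \<in> Z. \<not> R x y}) \<le> real (card Y) * (1 - \<delta>) ^ t" by blast
  define U where "U = {y \<in> Y. \<forall>x \<in> Z. \<not> R x y}"
  have fU: "finite U" unfolding U_def using fin by simp
  have "\<exists>x \<in> X. R x y" if "y \<in> U" for y
  proof -
    have "0 < card {x \<in> X. R x y}" using deg[of y] that d unfolding U_def by simp
    then show ?thesis by (auto simp: card_gt_0_iff)
  qed
  \<comment> \<open>What is still uncovered after \<open>t\<close> rounds gets one element each;
    this is the second summand of the bound.\<close>
  then obtain g where g: "\<And>y. y \<in> U \<Longrightarrow> g y \<in> X \<and> R (g y) y" by metis
  have "card (Z \<union> g ` U) \<le> t + card U"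
    using card_Un_le[of Z "g ` U"] Z(2) card_image_le[OF fU, of g] by linarith
  then have "real (card (Z \<union> g ` U)) \<le> real t + real (card Y) * (1 - \<delta>) ^ t"
    using Z(3) unfolding U_def by linarith
  moreover have "\<exists>x \<in> Z \<union> g ` U. R x y" if "y \<in> Y" for y
    using that g[of y] unfolding U_def by blast
  moreover have "Z \<union> g ` U \<subseteq> X" using Z(1) g by blast
  ultimately show ?thesis unfolding \<delta>_def by (intro exI[of _ "Z \<union> g ` U"]) blast
qed

text \<open>For \<open>r \<le> n / 2\<close>, double counting rewrites the left-hand side as
  \<open>(n choose r) / ((n - r + 3) choose 3)\<close>.\<close>

lemma choose_ratio_le:
  assumes r: "3 \<le> r" "r \<le> n" and h: "3 \<le> n div 2"
  shows "real (n choose (r - 3)) / real (r choose 3) \<le>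
    real (n choose (n div 2)) / real ((n div 2) choose 3)"
proof -
  have pos: "0 < (n div 2) choose 3" using h by simp
  show ?thesis
  proof (cases "n div 2 \<le> r")
    case True
    have "real ((n div 2) choose 3) \<le> real (r choose 3)"
      using binomial_right_mono[OF True, of 3] by simp
    moreover have "real (n choose (r - 3)) \<le> real (n choose (n div 2))"
      using binomial_maximum[of n "r - 3"] by simp
    ultimately show ?thesis using pos by (intro frac_le) auto
  next
    case False
    have "(n choose r) * (r choose (r - 3)) = (n choose (r - 3)) * ((n - (r - 3)) choose (r - (r - 3)))"
      using r by (intro choose_mult) auto
    moreover have "r choose (r - 3) = r choose 3" using r binomial_symmetric[of 3 r] by simp
    ultimately have eq: "(n choose r) * (r choose 3) = (n choose (r - 3)) * ((n - (r - 3)) choose 3)"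
      using r by simp
    have m: "n div 2 \<le> n - (r - 3)" using False by auto
    have le: "real ((n div 2) choose 3) \<le> real ((n - (r - 3)) choose 3)"
      using binomial_right_mono[OF m, of 3] by simp
    have "0 < r choose 3" "0 < (n - (r - 3)) choose 3" using r m h by auto
    then have "real (n choose (r - 3)) / real (r choose 3) = real (n choose r) / real ((n - (r - 3)) choose 3)"
      using arg_cong[OF eq, of real] by (simp add: field_simps)
    also have "\<dots> \<le> real (n choose (n div 2)) / real ((n div 2) choose 3)"
      using le pos binomial_maximum[of n r] by (intro frac_le) auto
    finally show ?thesis .
  qed
qed

text \<open>The bound is uniform in \<open>r\<close>, so all ranks from three on can be treated
  alike.\<close>

lemma cover_by_smaller_sets:
  assumes r: "3 \<le> r" "r \<le> n" and h: "6 \<le> n"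
  shows "\<exists>Z \<subseteq> {S. S \<subseteq> {1..n} \<and> card S = r - 3}.
    (\<forall>A \<subseteq> {1..n}. card A = r \<longrightarrow> (\<exists>S \<in> Z. S \<subseteq> A)) \<and>
    real (card Z) \<le> 3 * ln n * real (n choose (n div 2)) / real ((n div 2) choose 3) + 1 +
       real (n choose (n div 2)) / real n ^ 3"
proof -
  let ?X = "{S. S \<subseteq> {1..n} \<and> card S = r - 3}" and ?Y = "{A. A \<subseteq> {1..n} \<and> card A = r}"
  let ?B = "real (n choose (n div 2))"
  define m where "m = n choose (r - 3)"
  define d where "d = r choose 3"
  have cX: "card ?X = m" and cY: "card ?Y = n choose r" unfolding m_def by (simp_all add: n_subsets)
  have m0: "0 < m" unfolding m_def using r by simp
  have d0: "0 < d" unfolding d_def using r by simp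
  have deg: "card {S \<in> ?X. S \<subseteq> A} = d" if "A \<in> ?Y" for A
  proof -
    have "{S \<in> ?X. S \<subseteq> A} = {S. S \<subseteq> A \<and> card S = r - 3}" using that by auto
    moreover have "finite A" using that finite_subset by blast
    ultimately show ?thesis using that r binomial_symmetric[of 3 r] unfolding d_def by (simp add: n_subsets)
  qed
  have "?Y \<noteq> {}" using cY r by (metis card.empty less_irrefl zero_less_binomial)
  then obtain A where "A \<in> ?Y" by blast
  then have dm: "d \<le> m" using deg[of A] cX card_mono[of ?X "{S \<in> ?X. S \<subseteq> A}"] by auto
  \<comment> \<open>This many rounds make \<open>(1 - d / m) ^ t\<close> at most
    \<open>exp (- 3 * ln n) = 1 / n ^ 3\<close>. Rounding up causes the summand 1.\<close>
  define t where "t = nat \<lceil>real m / real d * (3 * ln n)\<rceil>"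
  have "\<exists>Z \<subseteq> ?X. (\<forall>A \<in> ?Y. \<exists>S \<in> Z. S \<subseteq> A) \<and>
      real (card Z) \<le> real t + real (card ?Y) * (1 - real d / real (card ?X)) ^ t"
  proof (rule greedy_cover)
    show "?X \<noteq> {}" using cX m0 by (metis card.empty less_irrefl)
    show "d \<le> card ?X" using dm cX by simp
    show "d \<le> card {S \<in> ?X. S \<subseteq> A}" if "A \<in> ?Y" for A using deg[OF that] by simp
  qed (use d0 in auto)
  then obtain Z where Z: "Z \<subseteq> ?X" "\<forall>A \<in> ?Y. \<exists>S \<in> Z. S \<subseteq> A"
    "real (card Z) \<le> real t + real (n choose r) * (1 - real d / real m) ^ t" unfolding cX cY by blast
  have ln0: "0 \<le> ln (real n)" using h by simp
  have t: "real m / real d * (3 * ln n) \<le> real t" "real t \<le> real m / real d * (3 * ln n) + 1"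
    unfolding t_def using ln0 by (simp_all add: real_nat_ceiling_ge)
  have "(1 - real d / real m) ^ t \<le> exp (- (real d / real m)) ^ t"
    using dm m0 exp_ge_add_one_self[of "- (real d / real m)"] by (intro power_mono) auto
  also have "\<dots> = exp (- (real d / real m * real t))" by (simp add: exp_of_nat_mult[symmetric] mult_ac)
  also have "\<dots> \<le> exp (- (3 * ln n))"
  proof -
    have "3 * ln n = real d / real m * (real m / real d * (3 * ln n))" using d0 m0 by simp
    also have "\<dots> \<le> real d / real m * real t" using t(1) by (intro mult_left_mono) auto
    finally show ?thesis by simp
  qed
  also have "\<dots> = 1 / real n ^ 3" using h by (simp add: exp_minus exp_of_nat_mult[of 3 "ln (real n)", simplified] field_simps)
  finally have small: "(1 - real d / real m) ^ t \<le> 1 / real n ^ 3" .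
  have "real (n choose r) * (1 - real d / real m) ^ t \<le> ?B * (1 / real n ^ 3)"
    using small binomial_maximum[of n r] dm m0 by (intro mult_mono) auto
  moreover have "real m / real d * (3 * ln n) \<le> ?B / real ((n div 2) choose 3) * (3 * ln n)"
    using choose_ratio_le[OF r] h ln0 unfolding m_def d_def by (intro mult_right_mono) auto
  ultimately have "real (card Z) \<le> ?B / real ((n div 2) choose 3) * (3 * ln n) + 1 + ?B * (1 / real n ^ 3)"
    using Z(3) t(2) by linarith
  then have "real (card Z) \<le> 3 * ln n * ?B / real ((n div 2) choose 3) + 1 + ?B / real n ^ 3"
    by (simp add: mult_ac)
  then show ?thesis using Z(1,2) by (intro exI[of _ Z]) auto
qed

section \<open>A lower bound on the number of matroids\<close>

definition relaxed_uniform :: "nat \<Rightarrow> nat \<Rightarrow> nat set set \<Rightarrow> nat indep_system" where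
  "relaxed_uniform n r H = \<lparr>ground = {1..n}, indep = {I. I \<subseteq> {1..n} \<and> card I \<le> r \<and> I \<notin> H}\<rparr>"

text \<open>These are the sparse paving matroids. Exchange by \<open>x\<close> can only fail when
  \<open>insert x I\<close> is in \<open>H\<close>; by \<open>sep\<close> any other element of
  \<open>J - I\<close> then works, and if there is none, \<open>J\<close> would equal
  \<open>insert x I\<close> and lie in \<open>H\<close>.\<close>

lemma is_matroid_relaxed_uniform:
  assumes r: "0 < r" and H: "\<And>X. X \<in> H \<Longrightarrow> card X = r"
    and sep: "\<And>I x y. \<lbrakk>x \<in> {1..n} - I; y \<in> {1..n} - I; insert x I \<in> H; insert y I \<in> H\<rbrakk> \<Longrightarrow> x = y"
  shows "is_matroid (relaxed_uniform n r H)" (is "is_matroid ?M")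
proof -
  have down: "J \<notin> H" if "I \<subseteq> {1..n}" "card I \<le> r" "I \<notin> H" "J \<subseteq> I" for I J
  proof
    assume "J \<in> H"
    moreover have "finite I" using that(1) finite_subset by blast
    ultimately have "J = I" using that H by (metis card_seteq)
    then show False using that \<open>J \<in> H\<close> by simp
  qed
  have exch: "\<exists>x \<in> J - I. insert x I \<subseteq> {1..n} \<and> card (insert x I) \<le> r \<and> insert x I \<notin> H"
    if I: "I \<subseteq> {1..n}" "card I \<le> r" "I \<notin> H" and J: "J \<subseteq> {1..n}" "card J \<le> r" "J \<notin> H"
      and lt: "card I < card J" for I J
  proof -
    have fin: "finite I" "finite J" using I J finite_subset by blast+
    obtain x where x: "x \<in> J - I" using lt fin by (metis card_mono Diff_eq_empty_iff ex_in_conv leD)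
    show ?thesis
    proof (cases "insert x I \<in> H")
      case False
      moreover have "card (insert x I) \<le> r" using x fin lt J by simp
      ultimately show ?thesis using x I J by blast
    next
      case True
      show ?thesis
      proof (cases "J - I = {x}")
        case sing: True
        have "J = insert x I"
        proof (rule card_seteq)
          show "J \<subseteq> insert x I" using sing by auto
          show "card (insert x I) \<le> card J" using x fin lt by simp
        qed (use fin in simp)
        then show ?thesis using True J by simp
      next
        case False
        then obtain y where y: "y \<in> J - I" "y \<noteq> x" using x by blast
        have "insert y I \<notin> H" using sep[of x I y] True x y J by blast
        moreover have "card (insert y I) \<le> r" using y fin lt J by simp
        ultimately show ?thesis using y I J by blast
      qed
    qed
  qed
  have "{} \<notin> H" using H r by fastforce
  moreover have "card J \<le> r" if "I \<subseteq> {1..n}" "card I \<le> r" "J \<subseteq> I" for I J :: "nat set"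
    using that by (meson card_mono finite_atLeastAtMost finite_subset le_trans)
  ultimately have indep: "{} \<in> indep ?M"
    and mem: "\<And>I. I \<in> indep ?M \<longleftrightarrow> I \<subseteq> {1..n} \<and> card I \<le> r \<and> I \<notin> H"
    and sub: "\<And>I J. I \<subseteq> {1..n} \<Longrightarrow> card I \<le> r \<Longrightarrow> J \<subseteq> I \<Longrightarrow> card J \<le> r"
    unfolding relaxed_uniform_def by simp_all
  show ?thesis unfolding is_matroid_def
  proof (intro conjI allI impI)
    show "finite (ground ?M)" unfolding relaxed_uniform_def by simp
    show "indep ?M \<subseteq> Pow (ground ?M)" unfolding relaxed_uniform_def by auto
    show "J \<in> indep ?M" if "I \<in> indep ?M" "J \<subseteq> I" for I J
      using that down[of I J] sub[of I J] unfolding mem by blast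
    show "\<exists>x \<in> J - I. insert x I \<in> indep ?M"
      if "I \<in> indep ?M" "J \<in> indep ?M" "card I < card J" for I J
      using that exch[of I J] unfolding mem by blast
  qed (rule indep)
qed

lemma finite_matroids_on: "finite (matroids_on n)"
proof -
  have "matroids_on n \<subseteq> (\<lambda>\<I>. \<lparr>ground = {1..n}, indep = \<I>\<rparr>) ` Pow (Pow {1..n})"
  proof
    fix M :: "nat indep_system" assume "M \<in> matroids_on n"
    then have g: "ground M = {1..n}" and "indep M \<subseteq> Pow (ground M)"
      unfolding matroids_on_def is_matroid_def by blast+
    then have "M = \<lparr>ground = {1..n}, indep = indep M\<rparr>" "indep M \<subseteq> Pow {1..n}" by simp_all
    then show "M \<in> (\<lambda>\<I>. \<lparr>ground = {1..n}, indep = \<I>\<rparr>) ` Pow (Pow {1..n})" by blast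
  qed
  then show ?thesis by (rule finite_subset) simp
qed

text \<open>Two \<open>r\<close>-sets with the same element sum modulo \<open>n\<close> never differ by a single exchange,
  and some residue class contains at least an \<open>n\<close>-th part of all \<open>r\<close>-sets.\<close>

lemma card_matroids_ge:
  assumes r: "0 < r" and n: "0 < n"
  shows "2 powr (real (n choose r) / real n) \<le> real (card (matroids_on n))"
proof -
  define X where "X = {A. A \<subseteq> {1..n} \<and> card A = r}"
  define C where "C c = {A \<in> X. \<Sum>A mod n = c}" for c
  have fX: "finite X" unfolding X_def by simp
  have "X = (\<Union>c<n. C c)" unfolding C_def using n by auto
  then have "card X \<le> (\<Sum>c<n. card (C c))" by (simp add: card_UN_le)
  moreover have "card X = n choose r" unfolding X_def using n_subsets[of "{1..n}" r] by simp
  ultimately have sum: "n choose r \<le> (\<Sum>c<n. card (C c))" by simp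
  have "\<exists>c<n. real (n choose r) / real n \<le> real (card (C c))"
  proof (rule ccontr)
    assume "\<not> ?thesis"
    then have "(\<Sum>c<n. real (card (C c))) < (\<Sum>c<n. real (n choose r) / real n)"
      using n by (intro sum_strict_mono) auto
    also have "\<dots> = real (n choose r)" using n by simp
    finally show False using sum by (metis leD of_nat_le_iff of_nat_sum)
  qed
  then obtain c where c: "real (n choose r) / real n \<le> real (card (C c))" by blast
  have sep: "x = y" if "x \<in> {1..n} - I" "y \<in> {1..n} - I" "insert x I \<in> C c" "insert y I \<in> C c" for x y I
  proof -
    have "finite I" using that unfolding C_def X_def by (metis (no_types, lifting) finite_atLeastAtMost finite_insert finite_subset mem_Collect_eq)
    then have "(x + \<Sum>I) mod n = (y + \<Sum>I) mod n" using that unfolding C_def by simp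
    then have "[x = y] (mod n)" by (simp add: cong_def[symmetric] cong_add_rcancel_nat)
    then have "int n dvd int x - int y" by (simp add: cong_iff_dvd_diff flip: cong_int_iff)
    moreover have "\<bar>int x - int y\<bar> < int n" using that by auto
    ultimately show ?thesis using zdvd_imp_le[of "int n" "\<bar>int x - int y\<bar>"] by auto
  qed
  have fC: "finite (C c)" using fX unfolding C_def by simp
  have "inj_on (relaxed_uniform n r) (Pow (C c))"
  proof (rule inj_onI)
    fix H K assume HK: "H \<in> Pow (C c)" "K \<in> Pow (C c)" "relaxed_uniform n r H = relaxed_uniform n r K"
    then have "A \<in> H \<longleftrightarrow> A \<in> K" if "A \<in> X" for A
      using that unfolding relaxed_uniform_def X_def by auto
    moreover have "H \<subseteq> X" "K \<subseteq> X" using HK unfolding C_def by auto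
    ultimately show "H = K" by blast
  qed
  moreover have "relaxed_uniform n r ` Pow (C c) \<subseteq> matroids_on n"
  proof
    fix M assume "M \<in> relaxed_uniform n r ` Pow (C c)"
    then obtain H where H: "H \<subseteq> C c" "M = relaxed_uniform n r H" by blast
    have "is_matroid M" unfolding H(2)
    proof (rule is_matroid_relaxed_uniform[OF r])
      show "card A = r" if "A \<in> H" for A using that H(1) unfolding C_def X_def by auto
      show "x = y" if "x \<in> {1..n} - I" "y \<in> {1..n} - I" "insert x I \<in> H" "insert y I \<in> H" for I x y
        using sep[OF that(1,2)] that(3,4) H(1) by blast
    qed
    then show "M \<in> matroids_on n" using H(2) unfolding matroids_on_def relaxed_uniform_def by simp
  qed
  ultimately have "card (Pow (C c)) \<le> card (matroids_on n)"
    by (metis card_image card_mono finite_matroids_on)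
  then have "2 ^ card (C c) \<le> card (matroids_on n)" using fC by (simp add: card_Pow)
  then have "2 powr real (card (C c)) \<le> real (card (matroids_on n))"
    by (metis numeral_power_le_of_nat_cancel_iff powr_realpow zero_less_numeral)
  moreover have "2 powr (real (n choose r) / real n) \<le> 2 powr real (card (C c))"
    using c by (intro powr_mono) auto
  ultimately show ?thesis by (rule order_trans[rotated])
qed

section \<open>Counting matroids without the given minor\<close>

definition rank_class :: "nat \<Rightarrow> nat \<Rightarrow> nat indep_system set" where
  "rank_class n r = {M \<in> matroids_on n. (\<forall>I \<in> indep M. card I \<le> r) \<and> (\<exists>B \<in> indep M. card B = r)}"

lemma extend_to_base:
  assumes M: "M \<in> rank_class n r" and I: "I \<in> indep M"
  shows "\<exists>B \<in> indep M. card B = r \<and> I \<subseteq> B"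
  using I
proof (induction "r - card I" arbitrary: I rule: less_induct)
  case less
  have exch: "\<forall>I J. I \<in> indep M \<longrightarrow> J \<in> indep M \<longrightarrow> card I < card J \<longrightarrow> (\<exists>x \<in> J - I. insert x I \<in> indep M)"
    and sub: "indep M \<subseteq> Pow (ground M)" and fin: "finite (ground M)"
    using M unfolding rank_class_def matroids_on_def is_matroid_def by blast+
  have le: "card I \<le> r" using M less.prems unfolding rank_class_def by blast
  show ?case
  proof (cases "card I = r")
    case True then show ?thesis using less.prems by blast
  next
    case False
    obtain B where B: "B \<in> indep M" "card B = r" using M unfolding rank_class_def by blast
    then have "card I < card B" using le False by simp
    then obtain x where x: "x \<in> B - I" "insert x I \<in> indep M" using exch less.prems B(1) by blast
    have "finite I" using less.prems sub fin finite_subset by blast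
    then have "r - card (insert x I) < r - card I" using x le False by simp
    then show ?thesis using less.hyps[OF _ x(2)] by blast
  qed
qed

lemma rank_class_eqI:
  assumes M: "M \<in> rank_class n r" "M' \<in> rank_class n r"
    and bases: "\<And>B. B \<subseteq> {1..n} \<Longrightarrow> card B = r \<Longrightarrow> B \<in> indep M \<longleftrightarrow> B \<in> indep M'"
  shows "M = M'"
proof -
  have le: "indep X \<subseteq> indep Y"
    if X: "X \<in> rank_class n r" and Y: "Y \<in> rank_class n r"
      and b: "\<And>B. B \<subseteq> {1..n} \<Longrightarrow> card B = r \<Longrightarrow> B \<in> indep X \<Longrightarrow> B \<in> indep Y" for X Y
  proof
    fix I assume "I \<in> indep X"
    then obtain B where B: "B \<in> indep X" "card B = r" "I \<subseteq> B" using extend_to_base[OF X] by blast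
    have "B \<subseteq> {1..n}" using X B(1) unfolding rank_class_def matroids_on_def is_matroid_def by blast
    then have "B \<in> indep Y" using b B by blast
    then show "I \<in> indep Y" using Y B(3) unfolding rank_class_def matroids_on_def is_matroid_def by blast
  qed
  have "indep M = indep M'" using le[OF M] le[OF M(2,1)] bases by blast
  moreover have "ground M = ground M'" using M unfolding rank_class_def matroids_on_def by simp
  ultimately show ?thesis by simp
qed

lemma card_rank_class_le: "card (rank_class n r) \<le> 2 ^ (n choose r)"
proof -
  let ?X = "{B. B \<subseteq> {1..n} \<and> card B = r}"
  have "inj_on (\<lambda>M. indep M \<inter> ?X) (rank_class n r)"
  proof (rule inj_onI)
    fix M M' assume M: "M \<in> rank_class n r" "M' \<in> rank_class n r" and eq: "indep M \<inter> ?X = indep M' \<inter> ?X"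
    show "M = M'" by (rule rank_class_eqI[OF M]) (use eq in blast)
  qed
  then have "card (rank_class n r) \<le> card (Pow ?X)" by (rule card_inj_on_le) auto
  then show ?thesis by (simp add: card_Pow n_subsets)
qed

text \<open>Whether an \<open>r\<close>-set \<open>B\<close> is a base can be read off the link of
  any \<open>S \<in> Z\<close> inside \<open>B\<close>, so the links over \<open>Z\<close> determine
  the matroid. The summand 1 accounts for the empty link of a dependent \<open>S\<close>.\<close>

lemma card_rank_class_cover:
  assumes link: "\<And>M S. \<lbrakk>M \<in> F; \<forall>I \<in> indep M. card I \<le> card S + 3; S \<in> indep M\<rbrakk> \<Longrightarrow> link n M S \<in> \<T>"
    and F: "F \<subseteq> rank_class n r" and r: "3 \<le> r" and fin: "finite \<T>"
    and Z: "Z \<subseteq> {S. S \<subseteq> {1..n} \<and> card S = r - 3}"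
      "\<And>A. A \<subseteq> {1..n} \<Longrightarrow> card A = r \<Longrightarrow> \<exists>S \<in> Z. S \<subseteq> A"
  shows "card F \<le> (card \<T> + 1) ^ card Z"
proof -
  have fZ: "finite Z" using Z(1) finite_subset[of Z "{S. S \<subseteq> {1..n} \<and> card S = r - 3}"] by simp
  let ?g = "\<lambda>M. \<lambda>S \<in> Z. link n M S"
  have "inj_on ?g F"
  proof (rule inj_onI)
    fix M M' assume M: "M \<in> F" "M' \<in> F" and eq: "?g M = ?g M'"
    have lk: "link n M S = link n M' S" if "S \<in> Z" for S using fun_cong[OF eq, of S] that by simp
    show "M = M'"
    proof (rule rank_class_eqI)
      show "M \<in> rank_class n r" "M' \<in> rank_class n r" using M F by auto
      fix B assume B: "B \<subseteq> {1..n}" "card B = r"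
      then obtain S where S: "S \<in> Z" "S \<subseteq> B" using Z(2) by blast
      have "finite B" using B(1) finite_subset by blast
      then have "card (B - S) = 3" using S Z(1) B(2) r by (subst card_Diff_subset) (auto intro: finite_subset)
      moreover have "B - S \<union> S = B" using S(2) by blast
      ultimately have "B \<in> indep X \<longleftrightarrow> B - S \<in> link n X S" for X
        using B(1) unfolding link_def by auto
      then show "B \<in> indep M \<longleftrightarrow> B \<in> indep M'" using lk[OF S(1)] by simp
    qed
  qed
  moreover have "?g ` F \<subseteq> Z \<rightarrow>\<^sub>E insert {} \<T>"
  proof
    fix h assume "h \<in> ?g ` F"
    then obtain M where M: "M \<in> F" "h = ?g M" by blast
    have "link n M S \<in> insert {} \<T>" if "S \<in> Z" for S
    proof (cases "S \<in> indep M")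
      case True
      have "\<forall>I \<in> indep M. card I \<le> r" using M(1) F unfolding rank_class_def by blast
      moreover have "card S + 3 = r" using that Z(1) r by auto
      ultimately show ?thesis using link[OF M(1) _ True] by simp
    next
      case False
      have down: "\<And>I J. I \<in> indep M \<Longrightarrow> J \<subseteq> I \<Longrightarrow> J \<in> indep M"
        using M(1) F unfolding rank_class_def matroids_on_def is_matroid_def by blast
      have "T \<notin> link n M S" for T using down[of "T \<union> S" S] False unfolding link_def by blast
      then show ?thesis by blast
    qed
    then show "h \<in> Z \<rightarrow>\<^sub>E insert {} \<T>" unfolding M(2) by (rule restrict_PiE_iff[THEN iffD2, rule_format])
  qed
  ultimately have "card F \<le> card (Z \<rightarrow>\<^sub>E insert {} \<T>)"
    using fZ fin by (intro card_inj_on_le[of ?g]) (auto intro: finite_PiE)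
  also have "\<dots> = card (insert {} \<T>) ^ card Z" using fZ by (simp add: card_PiE)
  also have "\<dots> \<le> (card \<T> + 1) ^ card Z" using fin by (intro power_mono) (auto simp: card_insert_if)
  finally show ?thesis .
qed

lemma matroids_on_rank_class: "matroids_on n \<subseteq> (\<Union>r \<le> n. rank_class n r)"
proof
  fix M assume M: "M \<in> matroids_on n"
  then have sub: "indep M \<subseteq> Pow {1..n}" "{} \<in> indep M" unfolding matroids_on_def is_matroid_def by blast+
  then have fin: "finite (indep M)" using finite_subset by blast
  define r where "r = Max (card ` indep M)"
  have "card I \<le> r" if "I \<in> indep M" for I unfolding r_def using fin that by simp
  moreover have "r \<in> card ` indep M" unfolding r_def using fin sub(2) by (intro Max_in) auto
  then obtain B where B: "B \<in> indep M" "card B = r" by auto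
  moreover have "r \<le> n"
  proof -
    have "B \<subseteq> {1..n}" using B(1) sub(1) by blast
    then show ?thesis using B(2) card_mono[of "{1..n}" B] by simp
  qed
  ultimately show "M \<in> (\<Union>r \<le> n. rank_class n r)" using M unfolding rank_class_def by blast
qed

section \<open>Asymptotic comparison of the two bounds\<close>

lemma ln_card_triple_systems:
  assumes n: "2 \<le> n"
  shows "ln (real (card (triple_systems n K) + 1)) \<le> (3 + K * (2 + ln (K + 1))) * (n * ln (real n + 1))"
proof -
  define l where "l = ln (real n + 1)"
  define a where "a = (real n + 1) ^ n * ((real (n * K) + 1) ^ K) ^ n * (real n + 1) * 2 ^ (n * K)"
  have l1: "1 \<le> l"
  proof -
    have "exp 1 \<le> real n + 1" using exp_le n by simp
    then show ?thesis unfolding l_def by (subst ln_ge_iff) auto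
  qed
  have ge1: "1 \<le> a" unfolding a_def by (intro mult_ge1_I one_le_power) auto
  have lnK: "ln (real (n * K) + 1) \<le> l + ln (K + 1)"
  proof -
    have "real (n * K) + 1 \<le> (real n + 1) * (real K + 1)" by (simp add: algebra_simps)
    then have "ln (real (n * K) + 1) \<le> ln ((real n + 1) * (real K + 1))"
      by (subst ln_le_cancel_iff) (auto simp: add_nonneg_pos)
    then show ?thesis unfolding l_def by (simp add: ln_mult_pos add.commute)
  qed
  have "real (card (triple_systems n K)) \<le> a"
    using of_nat_mono[OF card_triple_systems[of n K], where 'a = real] unfolding a_def
    by (simp only: of_nat_mult of_nat_power of_nat_add of_nat_1 of_nat_numeral)
  then have "ln (real (card (triple_systems n K) + 1)) \<le> ln (2 * a)" using ge1 by (subst ln_le_cancel_iff) auto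
  also have "ln (2 * a) = ln 2 + (n * l + n * (K * ln (real (n * K) + 1)) + l + n * K * ln 2)"
    using ge1 unfolding a_def l_def by (simp add: ln_mult_pos ln_realpow del: of_nat_mult)
  also have "\<dots> \<le> ln 2 + (n * l + n * (K * (l + ln (K + 1))) + l + n * K * ln 2)"
    using lnK by (intro add_mono mult_left_mono order_refl) auto
  \<comment> \<open>As \<open>l \<ge> 1\<close>, every term is raised to a multiple of
    \<open>n * l\<close>. The terms \<open>ln 2\<close>, \<open>n * l\<close> and \<open>l\<close>
    give the 3, the small label sets give \<open>K * (1 + ln (K + 1))\<close>, and the exceptional
    label set gives one more \<open>K\<close>.\<close>
  also have "\<dots>
      \<le> n * l + (n * l + n * (K * (l + ln (K + 1) * l)) + n * l + n * K * l)"
  proof (intro add_mono mult_left_mono order_refl)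
    have nl: "1 \<le> real n * l" using l1 n mult_mono[of 1 "real n" 1 l] by simp
    then show "ln 2 \<le> real n * l" using ln_le_minus_one[of 2] by simp
    show "l \<le> real n * l" using l1 n mult_right_mono[of 1 "real n" l] by simp
    show "ln (real (K + 1)) \<le> ln (real (K + 1)) * l" using l1 mult_left_mono[of 1 l "ln (real (K + 1))"] by simp
    show "ln 2 \<le> l" using l1 ln_le_minus_one[of 2] by simp
  qed auto
  also have "\<dots> = (3 + K * (2 + ln (K + 1))) * (n * l)" by (simp add: algebra_simps)
  finally show ?thesis unfolding l_def by (simp add: add.commute)
qed

text \<open>The central coefficient is the largest of the \<open>n + 1\<close> in its row, hence at
  least their average.\<close>

lemma central_binomial_ge: "2 ^ n / (real n + 1) \<le> real (n choose (n div 2))"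
proof -
  have "(2::nat) ^ n = (\<Sum>k\<le>n. n choose k)" by (simp add: choose_row_sum)
  also have "\<dots> \<le> (\<Sum>k\<le>n. n choose (n div 2))" by (intro sum_mono binomial_maximum)
  also have "\<dots> = (n + 1) * (n choose (n div 2))" by simp
  finally have "real (2 ^ n) \<le> real ((n + 1) * (n choose (n div 2)))" by (rule of_nat_mono)
  then show ?thesis by (simp add: field_simps)
qed

text \<open>Here \<open>n div 2\<close> is at least \<open>n / 3\<close> and
  \<open>m choose 3\<close> is at least \<open>(m / 3) ^ 3\<close>, so the constant is
  \<open>729 = 9 ^ 3\<close>.\<close>

lemma choose_3_ge:
  assumes "6 \<le> n"
  shows "real n ^ 3 / 729 \<le> real ((n div 2) choose 3)"
proof -
  have "real n / 3 \<le> real (n div 2)" using assms by linarith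
  then have "(real n / 9) ^ 3 \<le> (real (n div 2) / real 3) ^ 3" by (intro power_mono) auto
  also have "\<dots> \<le> real ((n div 2) choose 3)"
    using binomial_ge_n_over_k_pow_k[of 3 "n div 2", where 'a = real] assms by simp
  finally show ?thesis by (simp add: power_divide)
qed

text \<open>The bound is applied to each of the \<open>n + 1\<close> ranks. The factor
  \<open>2187 = 3 * 729\<close> combines \<open>3 * ln n\<close> from the greedy rounds with
  \<open>choose_3_ge\<close>. Ranks below three are too small for the cover; there a base is one of
  at most \<open>n ^ 2\<close> sets, which gives the term \<open>exp (n ^ 2 * ln 2)\<close>.\<close>

lemma card_excluded_le:
  assumes link: "\<And>M S. \<lbrakk>M \<in> matroids_on n; \<not> has_minor_iso M N; \<forall>I \<in> indep M. card I \<le> card S + 3;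
      S \<in> indep M\<rbrakk> \<Longrightarrow> link n M S \<in> triple_systems n K"
    and n: "6 \<le> n" and L: "ln (real (card (triple_systems n K) + 1)) \<le> L"
  shows "real (card {M \<in> matroids_on n. \<not> has_minor_iso M N}) \<le> (real n + 1) *
    (exp (L * (real (n choose (n div 2)) * (2187 * ln n + 1) / real n ^ 3 + 1)) + exp (real n ^ 2 * ln 2))"
proof -
  let ?F = "\<lambda>r. {M \<in> rank_class n r. \<not> has_minor_iso M N}"
  define B where "B = real (n choose (n div 2))"
  have L0: "0 \<le> L" using L ln_ge_zero[of "real (card (triple_systems n K) + 1)"] by linarith
  have "real (card (?F r)) \<le> exp (L * (B * (2187 * ln n + 1) / real n ^ 3 + 1)) + exp (real n ^ 2 * ln 2)"
    if r: "r \<le> n" for r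
  proof (cases "3 \<le> r")
    case True
    obtain Z where Z: "Z \<subseteq> {S. S \<subseteq> {1..n} \<and> card S = r - 3}"
      "\<forall>A \<subseteq> {1..n}. card A = r \<longrightarrow> (\<exists>S \<in> Z. S \<subseteq> A)"
      "real (card Z) \<le> 3 * ln n * B / real ((n div 2) choose 3) + 1 + B / real n ^ 3"
      using cover_by_smaller_sets[OF True r n] unfolding B_def by blast
    have "card (?F r) \<le> (card (triple_systems n K) + 1) ^ card Z"
    proof (rule card_rank_class_cover[OF _ _ True finite_triple_systems Z(1)])
      show "link n M S \<in> triple_systems n K"
        if "M \<in> ?F r" "\<forall>I \<in> indep M. card I \<le> card S + 3" "S \<in> indep M" for M S
        using link that unfolding rank_class_def by blast
    qed (use Z(2) in auto)
    then have "real (card (?F r)) \<le> real (card (triple_systems n K) + 1) ^ card Z"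
      by (metis of_nat_le_iff of_nat_power)
    also have "\<dots> = exp (ln (real (card (triple_systems n K) + 1)) * real (card Z))"
      by (simp add: exp_of_nat2_mult)
    also have "\<dots> \<le> exp (L * (B * (2187 * ln n + 1) / real n ^ 3 + 1))"
    proof -
      have ln0: "0 \<le> 3 * ln (real n) * B" using n unfolding B_def by simp
      have "3 * ln n * B / real ((n div 2) choose 3) \<le> 3 * ln n * B / (real n ^ 3 / 729)"
        using choose_3_ge[OF n] ln0 n by (intro divide_left_mono) auto
      then have "real (card Z) \<le> B * (2187 * ln n + 1) / real n ^ 3 + 1"
        using Z(3) by (simp add: field_simps add_divide_distrib)
      then show ?thesis using L L0 by (auto intro!: mult_mono)
    qed
    finally show ?thesis by (simp add: add_increasing2)
  next
    case False
    have "finite (rank_class n r)" using finite_matroids_on[of n] unfolding rank_class_def by simp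
    then have "card (?F r) \<le> card (rank_class n r)" by (intro card_mono) auto
    also have "\<dots> \<le> 2 ^ (n choose r)" by (rule card_rank_class_le)
    also have "\<dots> \<le> 2 ^ (n ^ 2)"
    proof (rule power_increasing)
      have "n choose r \<le> n ^ r" by (rule binomial_le_pow[OF r])
      also have "\<dots> \<le> n ^ 2" using False n by (intro power_increasing) auto
      finally show "n choose r \<le> n ^ 2" .
    qed simp
    finally have "real (card (?F r)) \<le> real (2 ^ (n ^ 2))" by (rule of_nat_mono)
    then have "real (card (?F r)) \<le> 2 ^ (n ^ 2)" by simp
    also have "\<dots> = exp (real n ^ 2 * ln 2)" by (simp add: exp_of_nat_mult flip: of_nat_power)
    finally show ?thesis by (simp add: add_increasing)
  qed
  then have each: "(\<Sum>r\<le>n. real (card (?F r))) \<le>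
      (\<Sum>r\<le>n. exp (L * (B * (2187 * ln n + 1) / real n ^ 3 + 1)) + exp (real n ^ 2 * ln 2))"
    by (intro sum_mono) auto
  have fin: "finite (?F r)" for r using finite_matroids_on[of n] unfolding rank_class_def by simp
  have "{M \<in> matroids_on n. \<not> has_minor_iso M N} \<subseteq> (\<Union>r \<le> n. ?F r)" using matroids_on_rank_class by blast
  then have "card {M \<in> matroids_on n. \<not> has_minor_iso M N} \<le> card (\<Union>r \<le> n. ?F r)"
    using fin by (intro card_mono) auto
  also have "\<dots> \<le> (\<Sum>r\<le>n. card (?F r))" by (intro card_UN_le) auto
  finally have "real (card {M \<in> matroids_on n. \<not> has_minor_iso M N}) \<le> (\<Sum>r\<le>n. real (card (?F r)))"
    unfolding of_nat_sum[symmetric] by (rule of_nat_mono)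
  then show ?thesis using each unfolding B_def by (simp add: add.commute)
qed

text \<open>The main part of the upper exponent is \<open>B / n\<close> times a factor tending to 0,
  so eventually it uses at most half of the lower exponent \<open>B / n * ln 2\<close>. The other
  half grows exponentially and absorbs the polynomially bounded rest, including the low
  ranks.\<close>

lemma excluded_ratio_tendsto_0:
  assumes N: "excluded N"
  shows "(\<lambda>n. real (card {M \<in> matroids_on n. \<not> has_minor_iso M N}) / real (card (matroids_on n))) \<longlonglongrightarrow> 0"
proof -
  obtain K where K: "\<And>n M S. \<lbrakk>M \<in> matroids_on n; \<not> has_minor_iso M N; \<forall>I \<in> indep M. card I \<le> card S + 3;
      S \<in> indep M\<rbrakk> \<Longrightarrow> link n M S \<in> triple_systems n K"
    using link_in_triple_systems[OF N] by blast
  define C where "C = 3 + real K * (2 + ln (real K + 1))"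
  have C0: "0 \<le> C" unfolding C_def by simp
  have small: "(\<lambda>n::nat. C * (ln (real n + 1) * (2187 * ln n + 1) / n)) \<longlonglongrightarrow> 0"
  proof (rule tendsto_mult_right_zero)
    show "(\<lambda>n::nat. ln (real n + 1) * (2187 * ln n + 1) / n) \<longlonglongrightarrow> 0" by real_asymp
  qed
  have ev1: "\<forall>\<^sub>F n in sequentially. C * (ln (real n + 1) * (2187 * ln n + 1) / n) < ln 2 / 2"
    using order_tendstoD(2)[OF small, of "ln 2 / 2"] by simp
  \<comment> \<open>Replacing \<open>C\<close> by \<open>n\<close> bounds \<open>L\<close> by
    \<open>n ^ 2 * ln (n + 1)\<close>, an expression without the parameter \<open>C\<close>.\<close>
  have ev2: "\<forall>\<^sub>F n in sequentially. C \<le> real n"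
    using eventually_ge_at_top[of "nat \<lceil>C\<rceil>"] by eventually_elim linarith
  \<comment> \<open>The binomial coefficient in the leftover half of the exponent is replaced by its
    lower bound \<open>2 ^ n / (n + 1)\<close>, so \<open>?h\<close> is an explicit function of
    \<open>n\<close> alone.\<close>
  let ?h = "\<lambda>n::nat. (real n + 1) * (exp (real n ^ 2 * ln (real n + 1) - 2 ^ n / (real n * (real n + 1)) * (ln 2 / 2)) +
      exp (real n ^ 2 * ln 2 - 2 ^ n / (real n * (real n + 1)) * ln 2))"
  have h: "?h \<longlonglongrightarrow> 0" by real_asymp
  have "\<forall>\<^sub>F n in sequentially.
      real (card {M \<in> matroids_on n. \<not> has_minor_iso M N}) / real (card (matroids_on n)) \<le> ?h n"
    using ev1 ev2 eventually_ge_at_top[of 6]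
  proof eventually_elim
    case (elim n)
    define B where "B = real (n choose (n div 2))"
    define L where "L = C * (n * ln (real n + 1))"
    define E where "E = 2 ^ n / (real n * (real n + 1))"
    have n: "6 \<le> n" by (rule elim(3))
    have L: "ln (real (card (triple_systems n K) + 1)) \<le> L"
      using ln_card_triple_systems[of n K] n unfolding L_def C_def by (simp add: add.commute)
    have up: "real (card {M \<in> matroids_on n. \<not> has_minor_iso M N}) \<le> (real n + 1) *
        (exp (L * (B * (2187 * ln n + 1) / real n ^ 3 + 1)) + exp (real n ^ 2 * ln 2))"
      unfolding B_def by (rule card_excluded_le[OF K n L])
    have BE: "E \<le> B / n"
    proof -
      have "E = 2 ^ n / (real n + 1) / n" unfolding E_def by simp
      also have "\<dots> \<le> B / n" using central_binomial_ge[of n] unfolding B_def by (intro divide_right_mono) auto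
      finally show ?thesis .
    qed
    have "2 powr (B / n) \<le> real (card (matroids_on n))"
      unfolding B_def using n by (intro card_matroids_ge) auto
    then have low: "exp (B / n * ln 2) \<le> real (card (matroids_on n))" by (simp add: powr_def)
    have lnL: "L \<le> real n ^ 2 * ln (real n + 1)"
    proof -
      have "L \<le> real n * (n * ln (real n + 1))" unfolding L_def using elim(2) by (intro mult_right_mono) auto
      then show ?thesis by (simp add: power2_eq_square mult.assoc)
    qed
    have "L * (B * (2187 * ln n + 1) / real n ^ 3) = B / n * (C * (ln (real n + 1) * (2187 * ln n + 1) / n))"
      unfolding L_def using n by (simp add: field_simps power3_eq_cube)
    also have "\<dots> \<le> B / n * (ln 2 / 2)"
      using elim(1) unfolding B_def by (intro mult_left_mono) auto
    finally have "L * (B * (2187 * ln n + 1) / real n ^ 3 + 1) - B / n * ln 2 \<le> L - B / n * (ln 2 / 2)"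
      by (simp add: algebra_simps)
    also have "\<dots> \<le> real n ^ 2 * ln (real n + 1) - E * (ln 2 / 2)"
      using lnL BE by (intro diff_mono mult_right_mono) auto
    finally have e1: "L * (B * (2187 * ln n + 1) / real n ^ 3 + 1) - B / n * ln 2 \<le>
        real n ^ 2 * ln (real n + 1) - E * (ln 2 / 2)" .
    have e2: "real n ^ 2 * ln 2 - B / n * ln 2 \<le> real n ^ 2 * ln 2 - E * ln 2"
      using BE by (intro diff_mono mult_right_mono) auto
    have "real (card {M \<in> matroids_on n. \<not> has_minor_iso M N}) / real (card (matroids_on n)) \<le>
        ((real n + 1) * (exp (L * (B * (2187 * ln n + 1) / real n ^ 3 + 1)) + exp (real n ^ 2 * ln 2))) / exp (B / n * ln 2)"
      using up low by (intro frac_le) auto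
    also have "\<dots> = (real n + 1) * (exp (L * (B * (2187 * ln n + 1) / real n ^ 3 + 1) - B / n * ln 2) +
        exp (real n ^ 2 * ln 2 - B / n * ln 2))"
      by (simp add: exp_diff add_divide_distrib distrib_left)
    also have "\<dots> \<le> (real n + 1) * (exp (real n ^ 2 * ln (real n + 1) - E * (ln 2 / 2)) +
        exp (real n ^ 2 * ln 2 - E * ln 2))"
      using e1 e2 by (intro mult_left_mono add_mono) auto
    finally show ?case unfolding E_def .
  qed
  then show ?thesis
    by (intro tendsto_sandwich[OF _ _ tendsto_const h]) auto
qed

theorem theorem1p2:
  fixes N :: "nat indep_system"
  assumes "(\<exists>k \<ge> 2. N = uniform_matroid 2 k) \<or> N = uniform_matroid 3 6 \<or>
           N = P6 \<or> N = Q6 \<or> N = R6"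
  shows "(\<lambda>n. real (card {M \<in> matroids_on n. \<not> has_minor_iso M N}) /
              real (card (matroids_on n))) \<longlonglongrightarrow> 0"
  using assms by (intro excluded_ratio_tendsto_0) (simp add: excluded_def)

end
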